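(* For the $3$ user interference channel with a single antenna at every node, frequency-selective channel coefficients constant in time (setting in the context), the degrees of freedom region is $$\mathcal{D}=\{(d_1,d_2,d_3)\in\mathbb{R}_+^3:\ d_1+d_2\le 1,\ d_2+d_3\le 1,\ d_1+d_3\le 1\}.$$
   Context: The $3$ user interference channel: for $k\in\{1,2,3\}$, frequency slot $f\in\mathbb{N}$ and time slot $t\in\mathbb{N}$, the output at receiver $k$ is $Y^{[k]}(f,t)=\sum_{j=1}^3 H^{[kj]}(f)X^{[j]}(f,t)+Z^{[k]}(f,t)$, where $X^{[j]}(f,t)$ is the input of transmitter $j$, $H^{[kj]}(f)$ is the channel coefficient from transmitter $j$ to receiver $k$ in frequency slot $f$ (varying across frequency slots but constant in time), and the $Z^{[k]}(f,t)$ are i.i.d. zero-mean unit-variance complex Gaussian noise. The channel coefficients are drawn i.i.d. from a continuous distribution, with absolute values bounded between a nonzero minimum and a finite maximum, and are known to all nodes. Transmitter $k$ has an independent message $W_k$ for receiver $k$. The total power over all transmitters is $\rho$ per orthogonal time and frequency dimension. Rates $R_k(\rho)=\log|W_k(\rho)|/(f_0t_0)$ for codewords over $f_0$ frequency and $t_0$ time slots are achievable if all error probabilities can be made simultaneously arbitrarily small for large $f_0t_0$; $\mathcal{C}(\rho)$ is the set of achievable rate tuples. The degrees of freedom region is the set of $(d_1,d_2,d_3)\in\mathbb{R}_+^3$ such that for all $(w_1,w_2,w_3)\in\mathbb{R}_+^3$, $\sum_k w_kd_k\le\limsup_{\rho\to\infty}\big[\sup_{\mathbf{R}(\rho)\in\mathcal{C}(\rho)}\sum_k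 w_kR_k(\rho)\big]/\log\rho$. *)

theory Defs
  imports "HOL-Probability.Probability"
begin

text \<open>Three user interference channel. Users/transmitters/receivers are indexed 0,1,2
  (the paper's 1,2,3). A channel realization is H :: nat \<times> nat \<times> nat \<Rightarrow> complex,
  H (k, j, f) being the coefficient from transmitter j to receiver k in frequency slot f.
  A code uses frequency slots 0..f0-1 and time slots 0..t0-1.\<close>

definition slots :: "nat \<Rightarrow> nat \<Rightarrow> (nat \<times> nat) set" where
  "slots f0 t0 = {..<f0} \<times> {..<t0}"

definition cnormal :: "complex measure" where
  "cnormal = density lborel (\<lambda>z. ennreal (exp (- (cmod z)\<^sup>2) / pi))"

definition noise :: "nat \<Rightarrow> nat \<Rightarrow> (nat \<times> nat \<Rightarrow> complex) measure" where
  "noise f0 t0 = PiM (slots f0 t0) (\<lambda>_. cnormal)"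

definition msgs :: "(nat \<Rightarrow> nat) \<Rightarrow> (nat \<Rightarrow> nat) set" where
  "msgs M = PiE {..<3} (\<lambda>k. {..<M k})"

definition rx :: "(nat \<times> nat \<times> nat \<Rightarrow> complex) \<Rightarrow> nat \<Rightarrow> nat
    \<Rightarrow> (nat \<Rightarrow> nat \<Rightarrow> nat \<times> nat \<Rightarrow> complex) \<Rightarrow> (nat \<Rightarrow> nat) \<Rightarrow> nat
    \<Rightarrow> (nat \<times> nat \<Rightarrow> complex) \<Rightarrow> (nat \<times> nat \<Rightarrow> complex)" where
  "rx H f0 t0 enc m k z =
     restrict (\<lambda>(f, t). (\<Sum>j<3. H (k, j, f) * enc j (m j) (f, t)) + z (f, t)) (slots f0 t0)"

definition err :: "(nat \<times> nat \<times> nat \<Rightarrow> complex) \<Rightarrow> nat \<Rightarrow> nat \<Rightarrow> (nat \<Rightarrow> nat)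
    \<Rightarrow> (nat \<Rightarrow> nat \<Rightarrow> nat \<times> nat \<Rightarrow> complex) \<Rightarrow> (nat \<Rightarrow> (nat \<times> nat \<Rightarrow> complex) \<Rightarrow> nat)
    \<Rightarrow> nat \<Rightarrow> real" where
  "err H f0 t0 M enc dec k =
     (\<Sum>m\<in>msgs M. measure (noise f0 t0)
         {z \<in> space (noise f0 t0). dec k (rx H f0 t0 enc m k z) \<noteq> m k})
     / real (\<Prod>j<3. M j)"

definition is_code :: "(nat \<times> nat \<times> nat \<Rightarrow> complex) \<Rightarrow> real \<Rightarrow> nat \<Rightarrow> nat \<Rightarrow> (nat \<Rightarrow> nat)
    \<Rightarrow> (nat \<Rightarrow> nat \<Rightarrow> nat \<times> nat \<Rightarrow> complex) \<Rightarrow> (nat \<Rightarrow> (nat \<times> nat \<Rightarrow> complex) \<Rightarrow> nat)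
    \<Rightarrow> bool" where
  "is_code H \<rho> f0 t0 M enc dec \<longleftrightarrow>
     0 < f0 \<and> 0 < t0 \<and> (\<forall>k<3. 0 < M k) \<and>
     (\<forall>m\<in>msgs M. (\<Sum>k<3. \<Sum>p\<in>slots f0 t0. (cmod (enc k (m k) p))\<^sup>2)
                    \<le> \<rho> * real f0 * real t0) \<and>
     (\<forall>k<3. dec k \<in> measurable (PiM (slots f0 t0) (\<lambda>_. borel)) (count_space UNIV))"

definition achievable :: "(nat \<times> nat \<times> nat \<Rightarrow> complex) \<Rightarrow> real \<Rightarrow> (nat \<Rightarrow> real) \<Rightarrow> bool" where
  "achievable H \<rho> R \<longleftrightarrow> (\<forall>k<3. 0 \<le> R k) \<and>
     (\<forall>\<epsilon>>0. \<forall>N. \<exists>f0 t0 M enc dec. N \<le> f0 * t0 \<and> is_code H \<rho> f0 t0 M enc dec \<and>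
        (\<forall>k<3. R k \<le> ln (real (M k)) / (real f0 * real t0) \<and> err H f0 t0 M enc dec k \<le> \<epsilon>))"

definition cap_region :: "(nat \<times> nat \<times> nat \<Rightarrow> complex) \<Rightarrow> real \<Rightarrow> (nat \<Rightarrow> real) set" where
  "cap_region H \<rho> = {R. achievable H \<rho> R}"

definition dof_region :: "(nat \<times> nat \<times> nat \<Rightarrow> complex) \<Rightarrow> (real \<times> real \<times> real) set" where
  "dof_region H = {(d1, d2, d3). 0 \<le> d1 \<and> 0 \<le> d2 \<and> 0 \<le> d3 \<and>
     (\<forall>w1 w2 w3. 0 \<le> w1 \<longrightarrow> 0 \<le> w2 \<longrightarrow> 0 \<le> w3 \<longrightarrow>
        ereal (w1 * d1 + w2 * d2 + w3 * d3)
        \<le> Limsup at_top (\<lambda>\<rho>::real.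
             (SUP R\<in>cap_region H \<rho>. ereal (w1 * R 0 + w2 * R 1 + w3 * R 2)) / ereal (ln \<rho>)))}"

end

theory Submission
  imports Defs "Jordan_Normal_Form.Determinant" "HOL-Real_Asymp.Real_Asymp"
begin

text \<open>Converse: receiver \<open>k\<close> decodes its own message, subtracts its user's signal and the signal of the
  third user (whose message is given to it), and rescales what is left into a copy of the output of
  receiver \<open>l\<close>; so, once its noise is reduced by a constant factor, it can decode both messages. A
  volume comparison then bounds the number of message pairs by \<open>(const * \<rho>) ^ n\<close>, that is
  \<open>R k + R l \<le> ln \<rho> + const\<close>.

  Achievability: by linear programming it suffices to reach the vertices \<open>(1,0,0)\<close>, \<open>(0,1,0)\<close>,
  \<open>(0,0,1)\<close> and \<open>(1/2,1/2,1/2)\<close>. The last is the limit of \<open>(n+1, n, n) / (2n+1)\<close>, reached by Cadambe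
  and Jafar's interference alignment over \<open>2n+1\<close> frequency slots followed by zero forcing. The
  zero-forced channels are used with a greedily packed code of Gaussian integer vectors whose squared
  minimum distance is proportional to the block length; this costs only a bounded rate, and the
  error probability decays exponentially in the block length for every fixed power.\<close>

section \<open>Complex Gaussian integrals\<close>

text \<open>Division by \<open>ln \<rho>\<close> forgives every rate loss that stays bounded as
  \<rho> grows, so crude exponential estimates are enough on both sides: counting takes the place of
  mutual information, and a packing that of random coding. The order of limits is what shapes the
  codes. At a fixed power the error has to vanish as the block grows, which a fixed uncoded
  constellation does not achieve; hence the growing minimum distance. In the converse, rescaling one
  received vector into another changes its noise level. Splitting each unit noise into a shared part
  and an independent remainder lets both decoders act on one noise vector, with their original error
  probabilities. The extra stream of one user comes from alignment around a loop. The alignment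
  conditions cannot all be met with equal exponents: closing the loop multiplies a beam by the loop
  gain and shifts its exponent by one. The user with \<open>n + 1\<close> beams absorbs this shift,
  and its share of the streams tends to that of the others.\<close>

lemma nn_integral_lborel_shift:
  fixes f :: "'a::euclidean_space \<Rightarrow> ennreal"
  assumes [measurable]: "f \<in> borel_measurable borel"
  shows "(\<integral>\<^sup>+x. f (x + c) \<partial>lborel) = (\<integral>\<^sup>+x. f x \<partial>lborel)"
proof -
  have "(\<integral>\<^sup>+x. f x \<partial>lborel) = (\<integral>\<^sup>+x. f x \<partial>distr lborel borel ((+) c))"
    by (simp add: lborel_distr_plus)
  also have "\<dots> = (\<integral>\<^sup>+x. f (c + x) \<partial>lborel)" by (subst nn_integral_distr) auto
  finally show ?thesis by (simp add: add.commute)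
qed

lemma nn_integral_complex_affine:
  fixes f :: "complex \<Rightarrow> ennreal"
  assumes [measurable]: "f \<in> borel_measurable borel" and b: "0 < b"
  shows "(\<integral>\<^sup>+x. f x \<partial>lborel) = ennreal (b\<^sup>2) * (\<integral>\<^sup>+x. f (c + of_real b * x) \<partial>lborel)"
  using b by (subst lborel_affine[of b c])
     (auto simp add: nn_integral_density nn_integral_distr nn_integral_cmult scaleR_conv_of_real)

lemma nn_integral_real_gaussian:
  assumes a: "0 < a"
  shows "(\<integral>\<^sup>+x. ennreal (exp (- a * x\<^sup>2)) \<partial>(lborel::real measure)) = ennreal (sqrt (pi / a))"
proof -
  have s: "0 < 1 / sqrt (2 * a)" using a by simp
  have nd: "normal_density 0 (1 / sqrt (2 * a)) x = sqrt (a / pi) * exp (- a * x\<^sup>2)" for x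
    using a by (simp add: normal_density_def power_divide real_sqrt_divide)
  interpret prob_space "density lborel (normal_density 0 (1 / sqrt (2 * a)))"
    by (rule prob_space_normal_density[OF s])
  have "1 = (\<integral>\<^sup>+x. ennreal (normal_density 0 (1 / sqrt (2 * a)) x) \<partial>lborel)"
    using emeasure_space_1 by (simp add: emeasure_density)
  also have "\<dots> = ennreal (sqrt (a / pi)) * (\<integral>\<^sup>+x. ennreal (exp (- a * x\<^sup>2)) \<partial>lborel)"
    unfolding nd using a by (subst nn_integral_cmult[symmetric]) (auto simp: ennreal_mult)
  finally have *: "1 = ennreal (sqrt (a / pi)) * (\<integral>\<^sup>+x. ennreal (exp (- a * x\<^sup>2)) \<partial>lborel)" .
  have inv: "ennreal (sqrt (pi / a)) * ennreal (sqrt (a / pi)) = 1"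
    using a by (simp add: ennreal_mult[symmetric] real_sqrt_mult[symmetric])
  have "ennreal (sqrt (pi / a)) = ennreal (sqrt (pi / a)) * (ennreal (sqrt (a / pi)) * (\<integral>\<^sup>+x. ennreal (exp (- a * x\<^sup>2)) \<partial>lborel))"
    using * by simp
  also have "\<dots> = (\<integral>\<^sup>+x. ennreal (exp (- a * x\<^sup>2)) \<partial>lborel)"
    unfolding mult.assoc[symmetric] inv by simp
  finally show ?thesis by (rule sym)
qed

lemma nn_integral_complex_gaussian:
  assumes a: "0 < a"
  shows "(\<integral>\<^sup>+z. ennreal (exp (- a * (cmod (z - c))\<^sup>2)) \<partial>lborel) = ennreal (pi / a)"
proof -
  have "(\<integral>\<^sup>+z. ennreal (exp (- a * (cmod (z - c))\<^sup>2)) \<partial>lborel)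
      = (\<integral>\<^sup>+z. ennreal (exp (- a * (cmod z)\<^sup>2)) \<partial>lborel)"
    by (subst nn_integral_lborel_shift[of _ c, symmetric]) auto
  also have "\<dots> = (\<integral>\<^sup>+z. (\<Prod>b\<in>Basis. ennreal (exp (- a * (z \<bullet> b)\<^sup>2))) \<partial>(lborel::complex measure))"
  proof (intro nn_integral_cong)
    fix z :: complex
    have "exp (- a * (cmod z)\<^sup>2) = exp (- a * (Re z)\<^sup>2) * exp (- a * (Im z)\<^sup>2)"
      unfolding cmod_power2 exp_add[symmetric] by (simp add: algebra_simps)
    then show "ennreal (exp (- a * (cmod z)\<^sup>2)) = (\<Prod>b\<in>Basis. ennreal (exp (- a * (z \<bullet> b)\<^sup>2)))"
      by (simp add: Basis_complex_def inner_complex_def ennreal_mult[symmetric])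
  qed
  also have "\<dots> = (\<Prod>b\<in>(Basis::complex set). ennreal (sqrt (pi / a)))"
    using nn_integral_real_gaussian[OF a] by (subst nn_integral_lborel_prod) auto
  also have "\<dots> = ennreal (pi / a)"
    using a by (simp add: power2_eq_square ennreal_mult[symmetric])
  finally show ?thesis .
qed

lemma sets_cnormal[simp, measurable_cong]: "sets cnormal = sets borel"
  by (simp add: cnormal_def)

lemma space_cnormal[simp]: "space cnormal = UNIV"
  by (simp add: cnormal_def)

lemma nn_integral_cnormal:
  assumes [measurable]: "f \<in> borel_measurable borel"
  shows "(\<integral>\<^sup>+z. f z \<partial>cnormal) = (\<integral>\<^sup>+z. ennreal (exp (- (cmod z)\<^sup>2) / pi) * f z \<partial>lborel)"
  unfolding cnormal_def by (subst nn_integral_density) auto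

text \<open>The squared modulus of a standard complex Gaussian is exponential with mean 1, so its
  moment generating function at 1/2 is 1 / (1 - 1/2). This 2 becomes the numerator of the tail base
  \<open>2 / exp 1\<close>.\<close>

lemma nn_integral_cnormal_exp_half:
  "(\<integral>\<^sup>+z. ennreal (exp ((cmod z)\<^sup>2 / 2)) \<partial>cnormal) = 2"
proof -
  have "(\<integral>\<^sup>+z. ennreal (exp ((cmod z)\<^sup>2 / 2)) \<partial>cnormal)
     = (\<integral>\<^sup>+z. ennreal (1 / pi) * ennreal (exp (- (1/2) * (cmod (z - 0))\<^sup>2)) \<partial>lborel)"
    by (subst nn_integral_cnormal)
      (auto intro!: nn_integral_cong simp: ennreal_mult[symmetric] exp_add[symmetric])
  also have "\<dots> = ennreal (1 / pi) * ennreal (pi / (1/2))"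
    by (subst nn_integral_cmult, simp, subst nn_integral_complex_gaussian) auto
  also have "\<dots> = 2" by (simp add: ennreal_mult[symmetric])
  finally show ?thesis .
qed

lemma prob_space_cnormal: "prob_space cnormal"
proof
  have "emeasure cnormal (space cnormal) = (\<integral>\<^sup>+z. 1 \<partial>cnormal)" by simp
  also have "\<dots> = (\<integral>\<^sup>+z. ennreal (1 / pi) * ennreal (exp (- 1 * (cmod (z - 0))\<^sup>2)) \<partial>lborel)"
    by (subst nn_integral_cnormal) (auto intro!: nn_integral_cong simp: ennreal_mult[symmetric])
  also have "\<dots> = ennreal (1 / pi) * ennreal (pi / 1)"
    by (subst nn_integral_cmult, simp, subst nn_integral_complex_gaussian) auto
  also have "\<dots> = 1" by (simp add: ennreal_mult[symmetric])
  finally show "emeasure cnormal (space cnormal) = 1" .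
qed

text \<open>Stability of the circular Gaussian, needed to split a receiver's noise into a shared
  part and an independent remainder. The shared weight \<open>a\<close> is complex since it will
  contain a ratio of channel coefficients; the weight of the remainder can be taken real and
  positive.\<close>

lemma nn_integral_cnormal_convolution:
  fixes a :: complex and b :: real
  assumes [measurable]: "g \<in> borel_measurable borel"
    and b: "0 < b" and ab: "(cmod a)\<^sup>2 + b\<^sup>2 = 1"
  shows "(\<integral>\<^sup>+z. (\<integral>\<^sup>+w. g (a * z + of_real b * w) \<partial>cnormal) \<partial>cnormal) = (\<integral>\<^sup>+y. g y \<partial>cnormal)"
proof -
  let ?\<phi> = "\<lambda>z::complex. ennreal (exp (- (cmod z)\<^sup>2) / pi)"
  interpret lborel_pair: pair_sigma_finite lborel "lborel :: complex measure" ..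
  have inner: "(\<integral>\<^sup>+w. g (a * z + of_real b * w) \<partial>cnormal)
      = (\<integral>\<^sup>+y. ennreal (1 / b\<^sup>2) * (?\<phi> ((y - a * z) / of_real b) * g y) \<partial>lborel)" for z
  proof -
    have "ennreal (b\<^sup>2) * (\<integral>\<^sup>+w. g (a * z + of_real b * w) \<partial>cnormal)
      = ennreal (b\<^sup>2) * (\<integral>\<^sup>+w. ?\<phi> w * g (a * z + of_real b * w) \<partial>lborel)"
      by (subst nn_integral_cnormal) auto
    also have "\<dots> = (\<integral>\<^sup>+y. ?\<phi> ((y - a * z) / of_real b) * g y \<partial>lborel)"
      using b by (subst nn_integral_complex_affine[of _ b "a * z"]) auto
    finally have "ennreal (1 / b\<^sup>2) * (ennreal (b\<^sup>2) * (\<integral>\<^sup>+w. g (a * z + of_real b * w) \<partial>cnormal))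
       = (\<integral>\<^sup>+y. ennreal (1 / b\<^sup>2) * (?\<phi> ((y - a * z) / of_real b) * g y) \<partial>lborel)"
      by (simp add: nn_integral_cmult)
    then show ?thesis using b by (simp add: mult.assoc[symmetric] ennreal_mult[symmetric])
  qed
  \<comment> \<open>Completing the square in \<open>z\<close>: as |a|^2 = 1 - b^2, the joint
    exponent separates into a Gaussian in \<open>z\<close> centred at \<open>cnj a * y\<close> and
    the standard exponent in \<open>y\<close>.\<close>
  have square: "(cmod z)\<^sup>2 + (cmod ((y - a * z) / of_real b))\<^sup>2
      = (1 / b\<^sup>2) * (cmod (z - cnj a * y))\<^sup>2 + (cmod y)\<^sup>2" for y z
  proof -
    have a2: "(Re a)\<^sup>2 + (Im a)\<^sup>2 = 1 - b\<^sup>2" using ab by (simp add: cmod_power2)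
    have "(cmod z)\<^sup>2 * b\<^sup>2 + (cmod (y - a * z))\<^sup>2 = (cmod (z - cnj a * y))\<^sup>2 + (cmod y)\<^sup>2 * b\<^sup>2"
    proof -
      have b2: "b\<^sup>2 = 1 - ((Re a)\<^sup>2 + (Im a)\<^sup>2)" using a2 by simp
      show ?thesis unfolding cmod_power2 b2 by (simp add: power2_eq_square algebra_simps)
    qed
    then show ?thesis using b by (simp add: norm_divide power_divide field_simps)
  qed
  have "(\<integral>\<^sup>+z. (\<integral>\<^sup>+w. g (a * z + of_real b * w) \<partial>cnormal) \<partial>cnormal)
     = (\<integral>\<^sup>+z. \<integral>\<^sup>+y. ?\<phi> z * (ennreal (1 / b\<^sup>2) * (?\<phi> ((y - a * z) / of_real b) * g y)) \<partial>lborel \<partial>lborel)"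
    unfolding inner by (subst nn_integral_cnormal) (auto simp: nn_integral_cmult)
  also have "\<dots> = (\<integral>\<^sup>+y. \<integral>\<^sup>+z. ?\<phi> z * (ennreal (1 / b\<^sup>2) * (?\<phi> ((y - a * z) / of_real b) * g y)) \<partial>lborel \<partial>lborel)"
    using b by (intro lborel_pair.Fubini') measurable
  also have "\<dots> = (\<integral>\<^sup>+y. \<integral>\<^sup>+z. (?\<phi> y * g y * ennreal (1 / (pi * b\<^sup>2))) * ennreal (exp (- (1 / b\<^sup>2) * (cmod (z - cnj a * y))\<^sup>2)) \<partial>lborel \<partial>lborel)"
  proof (intro nn_integral_cong)
    fix y z
    have "exp (- (cmod z)\<^sup>2) / pi * (1 / b\<^sup>2 * (exp (- (cmod ((y - a * z) / of_real b))\<^sup>2) / pi))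
      = exp (- ((cmod z)\<^sup>2 + (cmod ((y - a * z) / of_real b))\<^sup>2)) / (pi * b\<^sup>2 * pi)"
    proof -
      have "exp (- ((cmod z)\<^sup>2 + (cmod ((y - a * z) / of_real b))\<^sup>2))
        = exp (- (cmod z)\<^sup>2) * exp (- (cmod ((y - a * z) / of_real b))\<^sup>2)"
        unfolding exp_add[symmetric] by (rule arg_cong[of _ _ exp]) simp
      then show ?thesis by simp
    qed
    also have "\<dots> = exp (- (cmod y)\<^sup>2) / pi * (1 / (pi * b\<^sup>2) * exp (- (1 / b\<^sup>2) * (cmod (z - cnj a * y))\<^sup>2))"
    proof -
      have "exp (- (1 / b\<^sup>2 * (cmod (z - cnj a * y))\<^sup>2 + (cmod y)\<^sup>2))
        = exp (- (cmod y)\<^sup>2) * exp (- (1 / b\<^sup>2) * (cmod (z - cnj a * y))\<^sup>2)"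
        unfolding exp_add[symmetric] by (rule arg_cong[of _ _ exp]) simp
      then show ?thesis unfolding square by simp
    qed
    finally have e: "ennreal (exp (- (cmod z)\<^sup>2) / pi * (1 / b\<^sup>2 * (exp (- (cmod ((y - a * z) / of_real b))\<^sup>2) / pi)))
       = ennreal (exp (- (cmod y)\<^sup>2) / pi * (1 / (pi * b\<^sup>2) * exp (- (1 / b\<^sup>2) * (cmod (z - cnj a * y))\<^sup>2)))"
      by simp
    have "?\<phi> z * (ennreal (1 / b\<^sup>2) * (?\<phi> ((y - a * z) / of_real b) * g y))
       = (?\<phi> z * (ennreal (1 / b\<^sup>2) * ?\<phi> ((y - a * z) / of_real b))) * g y"
      by (simp add: mult.assoc)
    also have "\<dots> = (?\<phi> y * (ennreal (1 / (pi * b\<^sup>2)) * ennreal (exp (- (1 / b\<^sup>2) * (cmod (z - cnj a * y))\<^sup>2)))) * g y"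
    proof -
      have t: "ennreal (p * (q * r)) = ennreal p * (ennreal q * ennreal r)"
        if "0 \<le> p" "0 \<le> q" "0 \<le> r" for p q r
        using that by (simp add: ennreal_mult)
      have "?\<phi> z * (ennreal (1 / b\<^sup>2) * ?\<phi> ((y - a * z) / of_real b))
        = ?\<phi> y * (ennreal (1 / (pi * b\<^sup>2)) * ennreal (exp (- (1 / b\<^sup>2) * (cmod (z - cnj a * y))\<^sup>2)))"
        by (rule trans[OF trans[OF t[symmetric] e] t]) auto
      then show ?thesis by (simp only:)
    qed
    finally show "?\<phi> z * (ennreal (1 / b\<^sup>2) * (?\<phi> ((y - a * z) / of_real b) * g y))
       = (?\<phi> y * g y * ennreal (1 / (pi * b\<^sup>2))) * ennreal (exp (- (1 / b\<^sup>2) * (cmod (z - cnj a * y))\<^sup>2))"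
      by (simp add: mult_ac)
  qed
  also have "\<dots> = (\<integral>\<^sup>+y. ?\<phi> y * g y * (ennreal (1 / (pi * b\<^sup>2)) * ennreal (pi / (1 / b\<^sup>2))) \<partial>lborel)"
    using b by (subst nn_integral_cmult, simp, subst nn_integral_complex_gaussian) (auto simp: mult.assoc)
  also have "\<dots> = (\<integral>\<^sup>+y. g y \<partial>cnormal)"
    using b by (subst nn_integral_cnormal) (auto simp: ennreal_mult[symmetric])
  finally show ?thesis .
qed

section \<open>Gaussian vectors\<close>

abbreviation (input) gauss :: "'i set \<Rightarrow> ('i \<Rightarrow> complex) measure" where
  "gauss I \<equiv> PiM I (\<lambda>_. cnormal)"

lemma product_sigma_finite_cnormal: "product_sigma_finite (\<lambda>_. cnormal)"
  using prob_space_cnormal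
  by (auto simp: product_sigma_finite_def prob_space_def finite_measure_def)

lemma product_sigma_finite_lborel: "product_sigma_finite (\<lambda>_. lborel :: complex measure)"
  by (simp add: product_sigma_finite_def sigma_finite_lborel)

lemma prob_space_gauss: "prob_space (gauss I)"
  by (intro prob_space_PiM prob_space_cnormal)

lemma indicator_PiE_eq_prod:
  assumes "finite I" "z \<in> extensional I"
  shows "indicator (PiE I A) z = (\<Prod>i\<in>I. indicator (A i) (z i) :: ennreal)"
proof (cases "z \<in> PiE I A")
  case True
  then show ?thesis by (auto simp: PiE_iff indicator_def)
next
  case False
  then obtain i where "i \<in> I" "z i \<notin> A i" using assms by (auto simp: PiE_iff)
  then have "(\<Prod>i\<in>I. indicator (A i) (z i) :: ennreal) = 0"
    using assms by (intro prod_zero) (auto intro!: bexI[of _ i])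
  with False show ?thesis by simp
qed

text \<open>Chernoff bound with exponent 1/2: the expectation of \<open>exp (S / 2)\<close> is 2^n,
  and the threshold \<open>2 * n\<close> contributes \<open>exp (- n)\<close>. Since 2 < e, noise of
  squared norm at least \<open>2 * n\<close> is exponentially rare. Converse and achievability both
  rest on this.\<close>

lemma emeasure_gauss_tail:
  assumes "finite I"
  shows "emeasure (gauss I) {z \<in> space (gauss I). 2 * real (card I) \<le> (\<Sum>p\<in>I. (cmod (z p))\<^sup>2)}
    \<le> ennreal ((2 / exp 1) ^ card I)"
proof -
  interpret product_sigma_finite "\<lambda>_::'a. cnormal" by (rule product_sigma_finite_cnormal)
  let ?u = "\<lambda>z. \<Prod>p\<in>I. ennreal (exp ((cmod (z p))\<^sup>2 / 2))"
  have u: "?u z = ennreal (exp ((\<Sum>p\<in>I. (cmod (z p))\<^sup>2) / 2))" for z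
    using assms by (simp add: prod_ennreal exp_sum sum_divide_distrib)
  have "emeasure (gauss I) {z \<in> space (gauss I). 2 * real (card I) \<le> (\<Sum>p\<in>I. (cmod (z p))\<^sup>2)}
    \<le> emeasure (gauss I) {z \<in> space (gauss I). 1 \<le> ennreal (exp (- real (card I))) * ?u z}"
  proof (intro emeasure_mono subsetI)
    fix z assume "z \<in> {z \<in> space (gauss I). 2 * real (card I) \<le> (\<Sum>p\<in>I. (cmod (z p))\<^sup>2)}"
    then have z: "z \<in> space (gauss I)" and "0 \<le> - real (card I) + (\<Sum>p\<in>I. (cmod (z p))\<^sup>2) / 2"
      by auto
    then have "1 \<le> exp (- real (card I) + (\<Sum>p\<in>I. (cmod (z p))\<^sup>2) / 2)"
      by (simp only: one_le_exp_iff)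
    then have "1 \<le> exp (- real (card I)) * exp ((\<Sum>p\<in>I. (cmod (z p))\<^sup>2) / 2)"
      by (simp only: exp_add)
    with z show "z \<in> {z \<in> space (gauss I). 1 \<le> ennreal (exp (- real (card I))) * ?u z}"
      unfolding u by (auto simp: ennreal_mult[symmetric])
  qed measurable
  also have "\<dots> \<le> ennreal (exp (- real (card I))) * (\<integral>\<^sup>+z. ?u z \<partial>gauss I)"
    using nn_integral_Markov_inequality[of ?u "space (gauss I)" "gauss I" "ennreal (exp (- real (card I)))"]
    by (simp cong: nn_integral_cong)
  also have "(\<integral>\<^sup>+z. ?u z \<partial>gauss I) = ennreal (2 ^ card I)"
    using assms
    by (subst product_nn_integral_prod[where f = "\<lambda>_ x. ennreal (exp ((cmod x)\<^sup>2 / 2))"])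
      (auto simp: nn_integral_cnormal_exp_half ennreal_power[symmetric])
  also have "ennreal (exp (- real (card I))) * ennreal (2 ^ card I) = ennreal ((2 / exp 1) ^ card I)"
    by (simp add: ennreal_mult[symmetric] power_divide exp_minus field_simps exp_of_nat_mult[of _ 1, simplified])
  finally show ?thesis .
qed

text \<open>The weights may differ between coordinates because channel coefficients differ between
  frequencies. It is enough to compare boxes, where both integrals factor and the one-dimensional
  statement applies.\<close>

lemma gauss_convolution:
  fixes a :: "'i \<Rightarrow> complex" and b :: "'i \<Rightarrow> real"
  assumes I: "finite I" and b: "\<And>p. p \<in> I \<Longrightarrow> 0 < b p"
    and ab: "\<And>p. p \<in> I \<Longrightarrow> (cmod (a p))\<^sup>2 + (b p)\<^sup>2 = 1"
  shows "distr (gauss I \<Otimes>\<^sub>M gauss I) (gauss I)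
      (\<lambda>x. \<lambda>p\<in>I. a p * fst x p + of_real (b p) * snd x p) = gauss I"
proof -
  interpret product_sigma_finite "\<lambda>_::'i. cnormal" by (rule product_sigma_finite_cnormal)
  interpret G: prob_space "gauss I" by (rule prob_space_gauss)
  let ?F = "\<lambda>x. \<lambda>p\<in>I. a p * fst x p + of_real (b p) * snd x p"
  have [measurable]: "?F \<in> measurable (gauss I \<Otimes>\<^sub>M gauss I) (gauss I)"
    by measurable
  show ?thesis
  proof (rule PiM_eqI[OF I])
    fix A :: "'i \<Rightarrow> complex set" assume "\<And>i. i \<in> I \<Longrightarrow> A i \<in> sets cnormal"
    then have A[measurable]: "i \<in> I \<Longrightarrow> A i \<in> sets borel" for i by simp
    have [measurable]: "PiE I A \<in> sets (gauss I)"
      using I A by (intro sets_PiM_I_finite) auto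
    have "emeasure (distr (gauss I \<Otimes>\<^sub>M gauss I) (gauss I) ?F) (PiE I A)
       = (\<integral>\<^sup>+x. indicator (PiE I A) x \<partial>distr (gauss I \<Otimes>\<^sub>M gauss I) (gauss I) ?F)"
      by (subst nn_integral_indicator) auto
    also have "\<dots> = (\<integral>\<^sup>+x. indicator (PiE I A) (?F x) \<partial>(gauss I \<Otimes>\<^sub>M gauss I))"
      by (subst nn_integral_distr) auto
    also have "\<dots> = (\<integral>\<^sup>+z. (\<integral>\<^sup>+w. indicator (PiE I A) (?F (z, w)) \<partial>gauss I) \<partial>gauss I)"
      by (subst G.nn_integral_fst[symmetric]) auto
    also have "\<dots> = (\<integral>\<^sup>+z. (\<integral>\<^sup>+w. (\<Prod>p\<in>I. indicator (A p) (a p * z p + of_real (b p) * w p)) \<partial>gauss I) \<partial>gauss I)"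
      using I by (intro nn_integral_cong) (auto simp: indicator_PiE_eq_prod intro!: prod.cong)
    also have "\<dots> = (\<integral>\<^sup>+z. (\<Prod>p\<in>I. \<integral>\<^sup>+w. indicator (A p) (a p * z p + of_real (b p) * w) \<partial>cnormal) \<partial>gauss I)"
      using I by (intro nn_integral_cong product_nn_integral_prod) auto
    also have "\<dots> = (\<Prod>p\<in>I. \<integral>\<^sup>+z. \<integral>\<^sup>+w. indicator (A p) (a p * z + of_real (b p) * w) \<partial>cnormal \<partial>cnormal)"
      using I by (intro product_nn_integral_prod) auto
    also have "\<dots> = (\<Prod>p\<in>I. emeasure cnormal (A p))"
      using I by (intro prod.cong refl, subst nn_integral_cnormal_convolution) (auto simp: b ab)
    finally show "emeasure (distr (gauss I \<Otimes>\<^sub>M gauss I) (gauss I) ?F) (PiE I A)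
      = (\<Prod>p\<in>I. emeasure cnormal (A p))" .
  qed simp
qed

lemma nn_integral_gauss:
  assumes I: "finite I" and [measurable]: "f \<in> borel_measurable (PiM I (\<lambda>_. borel))"
  shows "(\<integral>\<^sup>+z. f z \<partial>gauss I)
    = (\<integral>\<^sup>+z. (\<Prod>p\<in>I. ennreal (exp (- (cmod (z p))\<^sup>2) / pi)) * f z \<partial>PiM I (\<lambda>_. lborel))"
proof -
  interpret C: product_sigma_finite "\<lambda>_::'a. cnormal" by (rule product_sigma_finite_cnormal)
  interpret L: product_sigma_finite "\<lambda>_::'a. lborel :: complex measure" by (rule product_sigma_finite_lborel)
  let ?\<phi> = "\<lambda>z::complex. ennreal (exp (- (cmod z)\<^sup>2) / pi)"
  have "density (PiM I (\<lambda>_. lborel)) (\<lambda>z. \<Prod>p\<in>I. ?\<phi> (z p)) = gauss I"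
  proof (rule C.PiM_eqI[OF I])
    show "sets (density (PiM I (\<lambda>_. lborel)) (\<lambda>z. \<Prod>p\<in>I. ?\<phi> (z p))) = sets (gauss I)"
      by (simp cong: sets_PiM_cong)
    fix A :: "'a \<Rightarrow> complex set" assume "\<And>i. i \<in> I \<Longrightarrow> A i \<in> sets cnormal"
    then have A[measurable]: "i \<in> I \<Longrightarrow> A i \<in> sets borel" for i by simp
    have [measurable]: "PiE I A \<in> sets (PiM I (\<lambda>_. lborel))"
      using I A by (intro sets_PiM_I_finite) auto
    have "emeasure (density (PiM I (\<lambda>_. lborel)) (\<lambda>z. \<Prod>p\<in>I. ?\<phi> (z p))) (PiE I A)
      = (\<integral>\<^sup>+z. (\<Prod>p\<in>I. ?\<phi> (z p)) * indicator (PiE I A) z \<partial>PiM I (\<lambda>_. lborel))"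
      by (subst emeasure_density) auto
    also have "\<dots> = (\<integral>\<^sup>+z. (\<Prod>p\<in>I. ?\<phi> (z p) * indicator (A p) (z p)) \<partial>PiM I (\<lambda>_. lborel))"
      using I by (intro nn_integral_cong)
        (auto simp: indicator_PiE_eq_prod prod.distrib space_PiM PiE_iff)
    also have "\<dots> = (\<Prod>p\<in>I. \<integral>\<^sup>+z. ?\<phi> z * indicator (A p) z \<partial>lborel)"
      using I by (intro L.product_nn_integral_prod) auto
    also have "\<dots> = (\<Prod>p\<in>I. emeasure cnormal (A p))"
      unfolding cnormal_def by (intro prod.cong refl emeasure_density[symmetric]) auto
    finally show "emeasure (density (PiM I (\<lambda>_. lborel)) (\<lambda>z. \<Prod>p\<in>I. ?\<phi> (z p))) (PiE I A)
      = (\<Prod>p\<in>I. emeasure cnormal (A p))" .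
  qed
  then show ?thesis by (subst nn_integral_density[symmetric]) auto
qed

lemma nn_integral_PiM_lborel_shift:
  fixes u :: "'i \<Rightarrow> complex"
  assumes I: "finite I" and [measurable]: "f \<in> borel_measurable (PiM I (\<lambda>_. borel))"
  shows "(\<integral>\<^sup>+z. f (\<lambda>p\<in>I. z p + u p) \<partial>PiM I (\<lambda>_. lborel)) = (\<integral>\<^sup>+z. f z \<partial>PiM I (\<lambda>_. lborel))"
proof -
  interpret L: product_sigma_finite "\<lambda>_::'i. lborel :: complex measure" by (rule product_sigma_finite_lborel)
  let ?L = "PiM I (\<lambda>_. lborel :: complex measure)" and ?F = "\<lambda>z. \<lambda>p\<in>I. z p + u p"
  have [measurable]: "?F \<in> measurable ?L ?L" by measurable
  have "distr ?L ?L ?F = ?L"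
  proof (rule L.PiM_eqI[OF I])
    fix A :: "'i \<Rightarrow> complex set" assume A: "\<And>i. i \<in> I \<Longrightarrow> A i \<in> sets lborel"
    then have [measurable]: "i \<in> I \<Longrightarrow> A i \<in> sets borel" for i by simp
    have [measurable]: "PiE I A \<in> sets ?L"
      using I A by (intro sets_PiM_I_finite) auto
    have "emeasure (distr ?L ?L ?F) (PiE I A) = (\<integral>\<^sup>+z. indicator (PiE I A) z \<partial>distr ?L ?L ?F)"
      by (subst nn_integral_indicator) auto
    also have "\<dots> = (\<integral>\<^sup>+z. indicator (PiE I A) (?F z) \<partial>?L)"
      by (subst nn_integral_distr) auto
    also have "\<dots> = (\<integral>\<^sup>+z. (\<Prod>p\<in>I. indicator (A p) (z p + u p)) \<partial>?L)"
      using I by (intro nn_integral_cong) (auto simp: indicator_PiE_eq_prod intro!: prod.cong)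
    also have "\<dots> = (\<Prod>p\<in>I. \<integral>\<^sup>+z. indicator (A p) (z + u p) \<partial>lborel)"
      using I by (intro L.product_nn_integral_prod) auto
    also have "\<dots> = (\<Prod>p\<in>I. emeasure lborel (A p))"
      by (intro prod.cong refl, subst nn_integral_lborel_shift) auto
    finally show "emeasure (distr ?L ?L ?F) (PiE I A) = (\<Prod>p\<in>I. emeasure lborel (A p))" .
  qed simp
  then have "(\<integral>\<^sup>+z. f z \<partial>?L) = (\<integral>\<^sup>+z. f z \<partial>distr ?L ?L ?F)" by simp
  also have "\<dots> = (\<integral>\<^sup>+z. f (?F z) \<partial>?L)" by (subst nn_integral_distr) auto
  finally show ?thesis by simp
qed

text \<open>The indicator of the ball is at most \<open>exp (n - l * S)\<close> for the squared norm
  \<open>S\<close> and \<open>l = n / R\<close>; this integrates to a product of Gaussian integrals.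
  The choice of \<open>l\<close> minimises \<open>exp (l * R) * (pi / l) ^ n\<close>. The result is
  the exact volume (pi R)^n / n! with n! replaced by its lower bound (n / e)^n.\<close>

lemma emeasure_lborel_ball_le:
  assumes I: "finite I" "I \<noteq> {}" and R: "0 < R"
  shows "emeasure (PiM I (\<lambda>_. lborel :: complex measure))
     {z \<in> space (PiM I (\<lambda>_. lborel)). (\<Sum>p\<in>I. (cmod (z p))\<^sup>2) \<le> R}
    \<le> ennreal ((exp 1 * pi * R / real (card I)) ^ card I)"
proof -
  interpret L: product_sigma_finite "\<lambda>_::'a. lborel :: complex measure" by (rule product_sigma_finite_lborel)
  let ?L = "PiM I (\<lambda>_. lborel :: complex measure)"
  define n where "n = card I"
  have n: "0 < n" using I by (auto simp: n_def card_gt_0_iff)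
  let ?l = "real n / R"
  have l: "0 < ?l" using n R by simp
  have "emeasure ?L {z \<in> space ?L. (\<Sum>p\<in>I. (cmod (z p))\<^sup>2) \<le> R}
     = (\<integral>\<^sup>+z. indicator {z \<in> space ?L. (\<Sum>p\<in>I. (cmod (z p))\<^sup>2) \<le> R} z \<partial>?L)"
    by (subst nn_integral_indicator) auto
  also have "\<dots> \<le> (\<integral>\<^sup>+z. ennreal (exp (real n)) * (\<Prod>p\<in>I. ennreal (exp (- ?l * (cmod (z p - 0))\<^sup>2))) \<partial>?L)"
  proof (intro nn_integral_mono)
    fix z
    have "ennreal (exp (real n)) * (\<Prod>p\<in>I. ennreal (exp (- ?l * (cmod (z p - 0))\<^sup>2)))
       = ennreal (exp (real n - ?l * (\<Sum>p\<in>I. (cmod (z p))\<^sup>2)))"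
      using I by (simp add: prod_ennreal exp_sum[symmetric] ennreal_mult[symmetric] exp_add[symmetric]
        sum_negf sum_distrib_left)
    moreover have "?l * S \<le> n" if "S \<le> R" for S
    proof -
      have "?l * S \<le> ?l * R" using that l by (intro mult_left_mono) auto
      then show ?thesis using R by simp
    qed
    ultimately show "indicator {z \<in> space ?L. (\<Sum>p\<in>I. (cmod (z p))\<^sup>2) \<le> R} z
      \<le> ennreal (exp (real n)) * (\<Prod>p\<in>I. ennreal (exp (- ?l * (cmod (z p - 0))\<^sup>2)))"
      by (auto simp: indicator_def)
  qed
  also have "\<dots> = ennreal (exp (real n)) * (\<Prod>p\<in>I. \<integral>\<^sup>+z. ennreal (exp (- ?l * (cmod (z - 0))\<^sup>2)) \<partial>lborel)"
    using I by (subst nn_integral_cmult, simp, subst L.product_nn_integral_prod[symmetric]) auto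
  also have "\<dots> = ennreal (exp (real n)) * ennreal ((pi / ?l) ^ n)"
    using l by (subst nn_integral_complex_gaussian) (use R in \<open>auto simp: n_def ennreal_power\<close>)
  also have "\<dots> = ennreal ((exp 1 * pi * R / real n) ^ n)"
    using n R by (simp add: ennreal_mult[symmetric] power_divide power_mult_distrib
       exp_of_nat_mult[of _ 1, simplified] field_simps)
  finally show ?thesis by (simp add: n_def)
qed

text \<open>Packing argument: the noise density is at most pi^-n, so after a shift each probability
  is at most pi^-n times the volume of a decoding region inside one common ball. A point lies in at
  most \<open>c\<close> of these regions, so the sum is at most \<open>c\<close> times pi^-n times
  the volume of the ball.\<close>

lemma sum_emeasure_gauss_shift_le:
  fixes u :: "'m \<Rightarrow> 'i \<Rightarrow> complex" and S :: "'m \<Rightarrow> ('i \<Rightarrow> complex) \<Rightarrow> bool"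
  assumes I: "finite I" "I \<noteq> {}" and fin: "finite W" and R: "0 < R"
    and S[measurable]: "\<And>m. m \<in> W \<Longrightarrow> Measurable.pred (PiM I (\<lambda>_. borel)) (S m)"
    and c: "\<And>y. card {m \<in> W. S m y} \<le> c"
    and uR: "\<And>m z. m \<in> W \<Longrightarrow> (\<Sum>p\<in>I. (cmod (z p))\<^sup>2) \<le> B \<Longrightarrow> (\<Sum>p\<in>I. (cmod (z p + u m p))\<^sup>2) \<le> R"
  shows "(\<Sum>m\<in>W. emeasure (gauss I)
      {z \<in> space (gauss I). S m (\<lambda>p\<in>I. z p + u m p) \<and> (\<Sum>p\<in>I. (cmod (z p))\<^sup>2) \<le> B})
    \<le> ennreal (real c * (exp 1 * R / real (card I)) ^ card I)"
proof -
  define n where "n = card I"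
  let ?L = "PiM I (\<lambda>_. lborel :: complex measure)"
  let ?V = "{y \<in> space ?L. (\<Sum>p\<in>I. (cmod (y p))\<^sup>2) \<le> R}"
  have V[measurable]: "?V \<in> sets ?L" by measurable
  have step: "emeasure (gauss I)
      {z \<in> space (gauss I). S m (\<lambda>p\<in>I. z p + u m p) \<and> (\<Sum>p\<in>I. (cmod (z p))\<^sup>2) \<le> B}
    \<le> (\<integral>\<^sup>+y. ennreal ((1 / pi) ^ n) * (indicator ?V y * indicator {y. S m y} y) \<partial>?L)" if m: "m \<in> W" for m
  proof -
    note [measurable] = S[OF m]
    let ?E = "{z \<in> space (gauss I). S m (\<lambda>p\<in>I. z p + u m p) \<and> (\<Sum>p\<in>I. (cmod (z p))\<^sup>2) \<le> B}"
    have "emeasure (gauss I) ?E = (\<integral>\<^sup>+z. indicator ?E z \<partial>gauss I)"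
      by (subst nn_integral_indicator) auto
    also have "\<dots> = (\<integral>\<^sup>+z. (\<Prod>p\<in>I. ennreal (exp (- (cmod (z p))\<^sup>2) / pi)) * indicator ?E z \<partial>?L)"
      using I(1) by (subst nn_integral_gauss) auto
    also have "\<dots> \<le> (\<integral>\<^sup>+z. (\<lambda>y. ennreal ((1 / pi) ^ n) * (indicator ?V y * indicator {y. S m y} y)) (\<lambda>p\<in>I. z p + u m p) \<partial>?L)"
    proof (intro nn_integral_mono)
      fix z assume z: "z \<in> space ?L"
      have "(\<Prod>p\<in>I. ennreal (exp (- (cmod (z p))\<^sup>2) / pi)) \<le> (\<Prod>p\<in>I. ennreal (1 / pi))"
        by (simp only: prod_ennreal divide_nonneg_pos exp_ge_zero pi_gt_zero zero_le_one)
          (intro ennreal_leI prod_mono, auto intro!: divide_right_mono)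
      also have "\<dots> = ennreal ((1 / pi) ^ n)" by (simp add: n_def ennreal_power)
      finally have le: "(\<Prod>p\<in>I. ennreal (exp (- (cmod (z p))\<^sup>2) / pi)) \<le> ennreal ((1 / pi) ^ n)" .
      have ind: "indicator ?E z \<le> (indicator ?V (\<lambda>p\<in>I. z p + u m p) * indicator {y. S m y} (\<lambda>p\<in>I. z p + u m p) :: ennreal)"
        using uR[OF m, of z] by (auto simp: indicator_def space_PiM)
      show "(\<Prod>p\<in>I. ennreal (exp (- (cmod (z p))\<^sup>2) / pi)) * indicator ?E z
        \<le> (\<lambda>y. ennreal ((1 / pi) ^ n) * (indicator ?V y * indicator {y. S m y} y)) (\<lambda>p\<in>I. z p + u m p)"
        using mult_mono[OF le ind] by simp
    qed
    also have "\<dots> = (\<integral>\<^sup>+y. ennreal ((1 / pi) ^ n) * (indicator ?V y * indicator {y. S m y} y) \<partial>?L)"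
      using I(1) by (subst nn_integral_PiM_lborel_shift) auto
    finally show ?thesis .
  qed
  have "(\<Sum>m\<in>W. emeasure (gauss I)
      {z \<in> space (gauss I). S m (\<lambda>p\<in>I. z p + u m p) \<and> (\<Sum>p\<in>I. (cmod (z p))\<^sup>2) \<le> B})
    \<le> (\<Sum>m\<in>W. \<integral>\<^sup>+y. ennreal ((1 / pi) ^ n) * (indicator ?V y * indicator {y. S m y} y) \<partial>?L)"
    by (intro sum_mono step)
  also have "\<dots> = (\<integral>\<^sup>+y. (\<Sum>m\<in>W. ennreal ((1 / pi) ^ n) * (indicator ?V y * indicator {y. S m y} y)) \<partial>?L)"
    by (subst nn_integral_sum) auto
  also have "\<dots> \<le> (\<integral>\<^sup>+y. ennreal ((1 / pi) ^ n * real c) * indicator ?V y \<partial>?L)"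
  proof (intro nn_integral_mono)
    fix y
    have "(\<Sum>m\<in>W. indicator {y. S m y} y :: ennreal) = of_nat (card {m \<in> W. S m y})"
      using fin by (simp add: indicator_def sum.If_cases Int_def)
    also have "\<dots> \<le> of_nat c" using c[of y] by simp
    finally have "ennreal ((1 / pi) ^ n) * (indicator ?V y * (\<Sum>m\<in>W. indicator {y. S m y} y))
      \<le> ennreal ((1 / pi) ^ n) * (indicator ?V y * of_nat c)"
      by (intro mult_left_mono) auto
    then show "(\<Sum>m\<in>W. ennreal ((1 / pi) ^ n) * (indicator ?V y * indicator {y. S m y} y))
      \<le> ennreal ((1 / pi) ^ n * real c) * indicator ?V y"
      by (simp add: sum_distrib_left sum_distrib_right ennreal_mult ennreal_of_nat_eq_real_of_nat mult_ac)
  qed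
  also have "\<dots> = ennreal ((1 / pi) ^ n * real c) * emeasure ?L ?V"
    by (subst nn_integral_cmult) auto
  also have "\<dots> \<le> ennreal ((1 / pi) ^ n * real c) * ennreal ((exp 1 * pi * R / real n) ^ n)"
    unfolding n_def by (intro mult_left_mono emeasure_lborel_ball_le I R) auto
  also have "\<dots> = ennreal (real c * (exp 1 * R / real n) ^ n)"
    using R by (simp add: ennreal_mult[symmetric] power_mult_distrib power_divide)
  finally show ?thesis by (simp add: n_def)
qed

section \<open>The two-user outer bound\<close>

lemma nn_integral_gauss_convolution:
  fixes a :: "'i \<Rightarrow> complex" and b :: "'i \<Rightarrow> real"
  assumes I: "finite I" and f[measurable]: "f \<in> borel_measurable (PiM I (\<lambda>_. borel))"
    and b: "\<And>p. p \<in> I \<Longrightarrow> 0 < b p"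
    and ab: "\<And>p. p \<in> I \<Longrightarrow> (cmod (a p))\<^sup>2 + (b p)\<^sup>2 = 1"
  shows "(\<integral>\<^sup>+w. (\<integral>\<^sup>+z. f (\<lambda>p\<in>I. a p * z p + of_real (b p) * w p) \<partial>gauss I) \<partial>gauss I)
    = (\<integral>\<^sup>+z. f z \<partial>gauss I)"
proof -
  interpret G: prob_space "gauss I" by (rule prob_space_gauss)
  interpret GG: pair_sigma_finite "gauss I" "gauss I" ..
  have m[measurable]: "(\<lambda>x. \<lambda>p\<in>I. a p * fst x p + of_real (b p) * snd x p)
      \<in> measurable (gauss I \<Otimes>\<^sub>M gauss I) (gauss I)" by measurable
  have "(\<integral>\<^sup>+z. f z \<partial>gauss I) = (\<integral>\<^sup>+z. f z \<partial>distr (gauss I \<Otimes>\<^sub>M gauss I) (gauss I)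
      (\<lambda>x. \<lambda>p\<in>I. a p * fst x p + of_real (b p) * snd x p))"
    by (simp add: gauss_convolution[OF I b ab])
  also have "\<dots> = (\<integral>\<^sup>+x. f (\<lambda>p\<in>I. a p * fst x p + of_real (b p) * snd x p) \<partial>(gauss I \<Otimes>\<^sub>M gauss I))"
    by (subst nn_integral_distr) auto
  also have "\<dots> = (\<integral>\<^sup>+w. (\<integral>\<^sup>+z. f (\<lambda>p\<in>I. a p * z p + of_real (b p) * w p) \<partial>gauss I) \<partial>gauss I)"
    by (subst GG.nn_integral_snd[symmetric]) auto
  finally show ?thesis by simp
qed

lemma nn_integral_add4:
  assumes "a \<in> borel_measurable M" "b \<in> borel_measurable M" "c \<in> borel_measurable M" "d \<in> borel_measurable M"
  shows "(\<integral>\<^sup>+z. a z + b z + c z + d z \<partial>M) = integral\<^sup>N M a + integral\<^sup>N M b + integral\<^sup>N M c + integral\<^sup>N M d"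
  using assms by (simp add: nn_integral_add)

lemma (in prob_space) nn_integral_split_sum:
  fixes F :: "'a \<Rightarrow> 'a \<Rightarrow> ennreal"
  assumes F: "\<And>w. w \<in> space M \<Longrightarrow> F w \<in> borel_measurable M"
    and F': "(\<lambda>w. \<integral>\<^sup>+v. F w v \<partial>M) \<in> borel_measurable M"
    and A: "A \<in> borel_measurable M" and B: "B \<in> borel_measurable M"
  shows "(\<integral>\<^sup>+w. \<integral>\<^sup>+v. F w v + A w + B v + c \<partial>M \<partial>M)
    = (\<integral>\<^sup>+w. \<integral>\<^sup>+v. F w v \<partial>M \<partial>M) + (\<integral>\<^sup>+w. A w \<partial>M) + (\<integral>\<^sup>+v. B v \<partial>M) + c"
proof -
  have "(\<integral>\<^sup>+v. F w v + A w + B v + c \<partial>M) = (\<integral>\<^sup>+v. F w v \<partial>M) + A w + (\<integral>\<^sup>+v. B v \<partial>M) + c"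
    if "w \<in> space M" for w
    using F[OF that] B by (simp add: nn_integral_add emeasure_space_1)
  then have "(\<integral>\<^sup>+w. \<integral>\<^sup>+v. F w v + A w + B v + c \<partial>M \<partial>M)
     = (\<integral>\<^sup>+w. (\<integral>\<^sup>+v. F w v \<partial>M) + A w + (\<integral>\<^sup>+v. B v \<partial>M) + c \<partial>M)"
    by (intro nn_integral_cong)
  also have "\<dots> = (\<integral>\<^sup>+w. \<integral>\<^sup>+v. F w v \<partial>M \<partial>M) + (\<integral>\<^sup>+w. A w \<partial>M) + (\<integral>\<^sup>+v. B v \<partial>M) + c"
    using F' A by (simp add: nn_integral_add emeasure_space_1)
  finally show ?thesis .
qed

text \<open>Both receivers' noises are simulated from one shared vector \<open>z\<close> scaled by \<open>s\<close> (resp. \<open>g p * s\<close>) plus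
  independent complementary noises \<open>w\<close> and \<open>v\<close>. For fixed \<open>w\<close> and \<open>v\<close> the joint decoder is a deterministic
  function of \<open>z + uk m / s\<close>, so the volume bound applies; \<open>c\<close> bounds the number of message tuples that
  one value of it can be decoded to.\<close>

lemma two_receiver_volume_bound:
  fixes uk ul :: "'m \<Rightarrow> 'i \<Rightarrow> complex" and g :: "'i \<Rightarrow> complex"
    and dk dl :: "('i \<Rightarrow> complex) \<Rightarrow> nat" and mk ml :: "'m \<Rightarrow> nat"
  assumes I: "finite I" "5 \<le> card I" and fin: "finite W" and s: "0 < s" "s < 1"
    and g: "\<And>p. p \<in> I \<Longrightarrow> cmod (g p) * s < 1"
    and dk[measurable]: "dk \<in> measurable (PiM I (\<lambda>_. borel)) (count_space UNIV)"
    and dl[measurable]: "dl \<in> measurable (PiM I (\<lambda>_. borel)) (count_space UNIV)"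
    and c: "\<And>y x. card {m \<in> W. dk y = mk m \<and> dl (\<lambda>p\<in>I. x p + (ul m p - g p * uk m p)) = ml m} \<le> c"
    and B0: "0 \<le> B" and B: "\<And>m. m \<in> W \<Longrightarrow> (\<Sum>p\<in>I. (cmod (uk m p))\<^sup>2) \<le> B"
    and ek: "(\<Sum>m\<in>W. emeasure (gauss I) {z \<in> space (gauss I). dk (\<lambda>p\<in>I. uk m p + z p) \<noteq> mk m})
        \<le> ennreal (real (card W) / 8)"
    and el: "(\<Sum>m\<in>W. emeasure (gauss I) {z \<in> space (gauss I). dl (\<lambda>p\<in>I. ul m p + z p) \<noteq> ml m})
        \<le> ennreal (real (card W) / 8)"
  shows "real (card W) \<le> 2 * real c * (exp 1 * (4 * card I + 2 * B / s\<^sup>2) / real (card I)) ^ card I"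
proof -
  interpret G: prob_space "gauss I" by (rule prob_space_gauss)
  let ?N = "gauss I"
  define n where "n = card I"
  \<comment> \<open>Bound for the squared norm of \<open>z + uk m / s\<close>, from |x + y|^2 \<le>
    2 |x|^2 + 2 |y|^2 with squared norms at most \<open>2 * n\<close> for the noise and
    \<open>B / s^2\<close> for the signal.\<close>
  define R where "R = 4 * real n + 2 * B / s\<^sup>2"
  have n: "5 \<le> n" and ne: "I \<noteq> {}" and R: "0 < R"
    using I B0 by (auto simp: n_def R_def intro!: add_pos_nonneg)
  \<comment> \<open>Standard deviations of the complementary noises: they restore unit variance next
    to the shared parts \<open>s * z\<close> and \<open>g p * s * z\<close>.\<close>
  define bk where "bk = sqrt (1 - s\<^sup>2)"
  define bl where "bl p = sqrt (1 - (cmod (g p) * s)\<^sup>2)" for p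
  have lt1: "x\<^sup>2 < 1" if "0 \<le> x" "x < 1" for x :: real
    using that by (simp add: power_less_one_iff abs_square_less_1)
  have bk: "0 < bk" "(cmod (of_real s))\<^sup>2 + bk\<^sup>2 = 1"
    using s lt1[of s] by (auto simp: bk_def)
  have bl: "0 < bl p" "(cmod (g p * of_real s))\<^sup>2 + (bl p)\<^sup>2 = 1" if "p \<in> I" for p
    using s g[OF that] lt1[of "cmod (g p) * s"] by (auto simp: bl_def norm_mult)
  \<comment> \<open>Here \<open>y\<close> stands for \<open>z + uk m / s\<close>, so
    \<open>s * y\<close> is the signal \<open>uk m\<close> with noise reduced to
    \<open>s * z\<close>. Multiplying by \<open>g\<close> and adding \<open>ul m - g * uk m\<close>
    replaces the signal by \<open>ul m\<close>, with noise \<open>g * s * z\<close>. The terms with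
    \<open>w\<close> and \<open>v\<close> bring both noises back to unit variance.\<close>
  define S where "S w v m y \<longleftrightarrow> dk (\<lambda>p\<in>I. of_real s * y p + of_real bk * w p) = mk m
     \<and> dl (\<lambda>p\<in>I. (g p * (of_real s * y p) + of_real (bl p) * v p) + (ul m p - g p * uk m p)) = ml m"
    for w v m and y :: "'i \<Rightarrow> complex"
  let ?sh = "\<lambda>m z. \<lambda>p\<in>I. z p + uk m p / of_real s"
  let ?in = "\<lambda>w v m. {z \<in> space ?N. S w v m (?sh m z) \<and> (\<Sum>p\<in>I. (cmod (z p))\<^sup>2) \<le> 2 * real n}"
  let ?bk = "\<lambda>m. {z \<in> space ?N. dk (\<lambda>p\<in>I. uk m p + z p) \<noteq> mk m}"
  let ?bl = "\<lambda>m. {z \<in> space ?N. dl (\<lambda>p\<in>I. ul m p + z p) \<noteq> ml m}"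
  let ?out = "{z \<in> space ?N. 2 * real n \<le> (\<Sum>p\<in>I. (cmod (z p))\<^sup>2)}"
  have dkG: "dk \<in> measurable ?N (count_space UNIV)" and dlG: "dl \<in> measurable ?N (count_space UNIV)"
    using dk dl by (simp_all cong: measurable_cong_sets sets_PiM_cong)
  have S_sh: "S w v m (?sh m z) \<longleftrightarrow>
      dk (\<lambda>p\<in>I. uk m p + (of_real s * z p + of_real bk * w p)) = mk m
    \<and> dl (\<lambda>p\<in>I. ul m p + ((g p * of_real s) * z p + of_real (bl p) * v p)) = ml m" for w v m z
  proof -
    have "(\<lambda>p\<in>I. of_real s * ?sh m z p + of_real bk * w p)
        = (\<lambda>p\<in>I. uk m p + (of_real s * z p + of_real bk * w p))"
      using s by (auto simp: field_simps restrict_def)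
    moreover have "(\<lambda>p\<in>I. (g p * (of_real s * ?sh m z p) + of_real (bl p) * v p) + (ul m p - g p * uk m p))
        = (\<lambda>p\<in>I. ul m p + ((g p * of_real s) * z p + of_real (bl p) * v p))"
      using s by (auto simp: field_simps restrict_def)
    ultimately show ?thesis unfolding S_def by (simp only:)
  qed
  note dk[measurable del] dl[measurable del]
  note dkG[measurable] dlG[measurable]
  have inm[measurable]: "(\<lambda>x. indicator (?in (fst x) (fst (snd x)) m) (snd (snd x)) :: ennreal)
      \<in> borel_measurable (?N \<Otimes>\<^sub>M ?N \<Otimes>\<^sub>M ?N)" for m
  proof -
    have "Measurable.pred (?N \<Otimes>\<^sub>M ?N \<Otimes>\<^sub>M ?N) (\<lambda>x. snd (snd x) \<in> ?in (fst x) (fst (snd x)) m)"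
      unfolding S_sh mem_Collect_eq by measurable
    then show ?thesis unfolding indicator_def by measurable
  qed
  have inm'[measurable]: "(\<lambda>x. indicator (?in w (fst x) m) (snd x) :: ennreal)
      \<in> borel_measurable (?N \<Otimes>\<^sub>M ?N)" if "w \<in> space ?N" for w m
    using measurable_compose[OF measurable_Pair1'[OF that] inm] by simp
  have in_sets: "?in w v m \<in> sets ?N" for w v m
    unfolding S_sh by measurable
  have bad_sets: "?bk m \<in> sets ?N" "?bl m \<in> sets ?N" for m
    by measurable
  have em[measurable]: "(\<lambda>v. emeasure ?N (?in w v m)) \<in> borel_measurable ?N" if w: "w \<in> space ?N" for w m
  proof -
    have "(\<lambda>v. \<integral>\<^sup>+z. indicator (?in w v m) z \<partial>?N) \<in> borel_measurable ?N"
      using G.borel_measurable_nn_integral_fst[OF inm'[OF w, of m]] by simp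
    then show ?thesis using in_sets by (simp add: nn_integral_indicator)
  qed
  have em'[measurable]: "(\<lambda>w. \<integral>\<^sup>+v. emeasure ?N (?in w v m) \<partial>?N) \<in> borel_measurable ?N" for m
  proof -
    have "(\<lambda>w. \<integral>\<^sup>+v. \<integral>\<^sup>+z. indicator (?in w v m) z \<partial>?N \<partial>?N) \<in> borel_measurable ?N"
    proof -
      have "(\<lambda>x. (fst (fst x), snd (fst x), snd x)) \<in> measurable ((?N \<Otimes>\<^sub>M ?N) \<Otimes>\<^sub>M ?N) (?N \<Otimes>\<^sub>M ?N \<Otimes>\<^sub>M ?N)"
        by measurable
      from measurable_compose[OF this inm[of m]]
      have "(\<lambda>x. indicator (?in (fst (fst x)) (snd (fst x)) m) (snd x) :: ennreal)
          \<in> borel_measurable ((?N \<Otimes>\<^sub>M ?N) \<Otimes>\<^sub>M ?N)" by simp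
      from G.borel_measurable_nn_integral_fst[OF G.borel_measurable_nn_integral_fst[OF this]]
      show ?thesis by simp
    qed
    then show ?thesis using in_sets by (simp add: nn_integral_indicator)
  qed
  have packing: "(\<Sum>m\<in>W. emeasure ?N (?in w v m)) \<le> ennreal (real c * (exp 1 * R / real n) ^ n)"
    if wv: "w \<in> space ?N" "v \<in> space ?N" for w v
    unfolding n_def
  proof (rule sum_emeasure_gauss_shift_le[OF I(1) ne fin R])
    fix m assume "m \<in> W"
    show "Measurable.pred (PiM I (\<lambda>_. borel)) (S w v m)"
      unfolding S_def by measurable
  next
    fix y show "card {m \<in> W. S w v m y} \<le> c" unfolding S_def by (rule c)
  next
    fix m and z :: "'i \<Rightarrow> complex"
    assume m: "m \<in> W" and z: "(\<Sum>p\<in>I. (cmod (z p))\<^sup>2) \<le> 2 * real (card I)"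
    have "(cmod (x + y))\<^sup>2 \<le> 2 * (cmod x)\<^sup>2 + 2 * (cmod y)\<^sup>2" for x y :: complex
    proof -
      have "(cmod (x + y))\<^sup>2 \<le> (cmod x + cmod y)\<^sup>2"
        by (intro power_mono norm_triangle_ineq) auto
      also have "\<dots> \<le> 2 * (cmod x)\<^sup>2 + 2 * (cmod y)\<^sup>2"
        using zero_le_power2[of "cmod x - cmod y"] by (simp add: power2_sum power2_diff)
      finally show ?thesis .
    qed
    then have "(\<Sum>p\<in>I. (cmod (z p + uk m p / of_real s))\<^sup>2)
       \<le> (\<Sum>p\<in>I. 2 * (cmod (z p))\<^sup>2 + 2 * (cmod (uk m p / of_real s))\<^sup>2)"
      by (intro sum_mono)
    also have "\<dots> = 2 * (\<Sum>p\<in>I. (cmod (z p))\<^sup>2) + 2 * (\<Sum>p\<in>I. (cmod (uk m p))\<^sup>2) / s\<^sup>2"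
      using s by (simp add: sum.distrib sum_distrib_left sum_divide_distrib norm_divide power_divide)
    also have "\<dots> \<le> 2 * (2 * real (card I)) + 2 * B / s\<^sup>2"
      using z B[OF m] by (intro add_mono divide_right_mono mult_left_mono) auto
    finally show "(\<Sum>p\<in>I. (cmod (z p + uk m p / of_real s))\<^sup>2) \<le> R" by (simp add: R_def n_def)
  qed
  \<comment> \<open>For each triple of noises either both decodings succeed with \<open>z\<close> in
    the ball, or one decoder errs, or \<open>z\<close> is in the tail. Averaged over the
    complementary noise, each simulated noise is standard again, so the two error terms become the
    original error probabilities.\<close>
  have one: "1 \<le> (\<integral>\<^sup>+w. \<integral>\<^sup>+v. emeasure ?N (?in w v m) \<partial>?N \<partial>?N)
       + emeasure ?N (?bk m) + emeasure ?N (?bl m) + emeasure ?N ?out" for m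
  proof -
    let ?Yk = "\<lambda>w z. \<lambda>p\<in>I. of_real s * z p + of_real bk * w p"
    let ?Yl = "\<lambda>v z. \<lambda>p\<in>I. (g p * of_real s) * z p + of_real (bl p) * v p"
    have "1 = (\<integral>\<^sup>+w. \<integral>\<^sup>+v. \<integral>\<^sup>+z. 1 \<partial>?N \<partial>?N \<partial>?N)" by (simp add: G.emeasure_space_1)
    also have "\<dots> \<le> (\<integral>\<^sup>+w. \<integral>\<^sup>+v. \<integral>\<^sup>+z. indicator (?in w v m) z + indicator (?bk m) (?Yk w z)
        + indicator (?bl m) (?Yl v z) + indicator ?out z \<partial>?N \<partial>?N \<partial>?N)"
    proof (intro nn_integral_mono)
      fix w v z assume wvz: "w \<in> space ?N" "v \<in> space ?N" "z \<in> space ?N"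
      have "?Yk w z \<in> space ?N" "?Yl v z \<in> space ?N" by (auto simp: space_PiM)
      then have "z \<in> ?in w v m \<or> ?Yk w z \<in> ?bk m \<or> ?Yl v z \<in> ?bl m \<or> z \<in> ?out"
        using wvz(3) unfolding S_sh by (auto simp: restrict_def cong: if_cong)
      then show "(1::ennreal) \<le> indicator (?in w v m) z + indicator (?bk m) (?Yk w z)
        + indicator (?bl m) (?Yl v z) + indicator ?out z"
        by (auto simp: indicator_def)
    qed
    also have "\<dots> = (\<integral>\<^sup>+w. \<integral>\<^sup>+v. emeasure ?N (?in w v m) + (\<integral>\<^sup>+z. indicator (?bk m) (?Yk w z) \<partial>?N)
        + (\<integral>\<^sup>+z. indicator (?bl m) (?Yl v z) \<partial>?N) + emeasure ?N ?out \<partial>?N \<partial>?N)"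
    proof (intro nn_integral_cong)
      fix w v assume wv: "w \<in> space ?N" "v \<in> space ?N"
      have [measurable]: "(\<lambda>z. indicator (?in w v m) z :: ennreal) \<in> borel_measurable ?N"
        by (rule borel_measurable_indicator[OF in_sets])
      have Y: "?Yk w \<in> measurable ?N ?N" "?Yl v \<in> measurable ?N ?N"
        by (intro measurable_restrict; measurable)+
      show "(\<integral>\<^sup>+z. indicator (?in w v m) z + indicator (?bk m) (?Yk w z)
        + indicator (?bl m) (?Yl v z) + indicator ?out z \<partial>?N) = emeasure ?N (?in w v m) + (\<integral>\<^sup>+z. indicator (?bk m) (?Yk w z) \<partial>?N)
        + (\<integral>\<^sup>+z. indicator (?bl m) (?Yl v z) \<partial>?N) + emeasure ?N ?out"
      proof -
        have [measurable]: "indicator (?in w v m) \<in> borel_measurable ?N"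
          by (rule borel_measurable_indicator[OF in_sets])
        have e: "(\<integral>\<^sup>+z. indicator (?in w v m) z \<partial>?N) = emeasure ?N (?in w v m)"
          by (rule nn_integral_indicator[OF in_sets])
        have o: "?out \<in> sets ?N" by measurable
        show ?thesis
          unfolding e[symmetric] nn_integral_indicator[OF o, symmetric]
          by (rule nn_integral_add4[OF borel_measurable_indicator[OF in_sets]
            measurable_compose[OF Y(1) borel_measurable_indicator[OF bad_sets(1)]]
            measurable_compose[OF Y(2) borel_measurable_indicator[OF bad_sets(2)]]
            borel_measurable_indicator[OF o]])
      qed
    qed
    also have "\<dots> = (\<integral>\<^sup>+w. \<integral>\<^sup>+v. emeasure ?N (?in w v m) \<partial>?N \<partial>?N) + (\<integral>\<^sup>+w. \<integral>\<^sup>+z. indicator (?bk m) (?Yk w z) \<partial>?N \<partial>?N)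
        + (\<integral>\<^sup>+v. \<integral>\<^sup>+z. indicator (?bl m) (?Yl v z) \<partial>?N \<partial>?N) + emeasure ?N ?out"
    proof -
      have Y: "(\<lambda>x. ?Yk (fst x) (snd x)) \<in> measurable (?N \<Otimes>\<^sub>M ?N) ?N"
        "(\<lambda>x. ?Yl (fst x) (snd x)) \<in> measurable (?N \<Otimes>\<^sub>M ?N) ?N"
        by (intro measurable_restrict; measurable)+
      show ?thesis
      proof (rule G.nn_integral_split_sum[OF em em'])
        show "(\<lambda>w. \<integral>\<^sup>+z. indicator (?bk m) (?Yk w z) \<partial>?N) \<in> borel_measurable ?N"
          using G.borel_measurable_nn_integral_fst[OF measurable_compose[OF Y(1) borel_measurable_indicator[OF bad_sets(1)]]]
          by (simp only: fst_conv snd_conv)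
        show "(\<lambda>v. \<integral>\<^sup>+z. indicator (?bl m) (?Yl v z) \<partial>?N) \<in> borel_measurable ?N"
          using G.borel_measurable_nn_integral_fst[OF measurable_compose[OF Y(2) borel_measurable_indicator[OF bad_sets(2)]]]
          by (simp only: fst_conv snd_conv)
      qed
    qed
    also have "(\<integral>\<^sup>+w. \<integral>\<^sup>+z. indicator (?bk m) (?Yk w z) \<partial>?N \<partial>?N) = emeasure ?N (?bk m)"
      using bk by (subst nn_integral_gauss_convolution[OF I(1), where b="\<lambda>_. bk"]) auto
    also have "(\<integral>\<^sup>+v. \<integral>\<^sup>+z. indicator (?bl m) (?Yl v z) \<partial>?N \<partial>?N) = emeasure ?N (?bl m)"
      using bl by (subst nn_integral_gauss_convolution[OF I(1)]) auto
    finally show ?thesis .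
  qed
  have tail: "emeasure ?N ?out \<le> ennreal (1 / 4)"
  proof -
    \<comment> \<open>Five is the least exponent for which the power of 2/e is below 1/4, which
      explains the lower bound on the block length.\<close>
    have "(2 / exp 1 :: real) ^ n \<le> (2 / exp 1) ^ 5"
      using n exp_ge_add_one_self[of "1::real"] by (intro power_decreasing) (auto simp: divide_le_eq)
    also have "\<dots> \<le> (2 / (2718281 / 1000000 :: real)) ^ 5"
    proof -
      have "(2718281 / 1000000::real) \<le> exp 1" using abs_diff_le_iff[THEN iffD1, OF e_approx_32] by simp
      then show ?thesis by (intro power_mono divide_left_mono) auto
    qed
    also have "\<dots> \<le> 1 / 4" by (simp add: power_divide)
    finally show ?thesis
      using emeasure_gauss_tail[OF I(1)] unfolding n_def[symmetric] by (meson ennreal_leI order_trans)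
  qed
  have "(\<Sum>m\<in>W. \<integral>\<^sup>+w. \<integral>\<^sup>+v. emeasure ?N (?in w v m) \<partial>?N \<partial>?N)
      = (\<integral>\<^sup>+w. \<integral>\<^sup>+v. (\<Sum>m\<in>W. emeasure ?N (?in w v m)) \<partial>?N \<partial>?N)"
    by (simp add: nn_integral_sum[symmetric] em cong: nn_integral_cong)
  also have "\<dots> \<le> (\<integral>\<^sup>+w. \<integral>\<^sup>+v. ennreal (real c * (exp 1 * R / real n) ^ n) \<partial>?N \<partial>?N)"
    by (intro nn_integral_mono packing)
  also have "\<dots> = ennreal (real c * (exp 1 * R / real n) ^ n)" by (simp add: G.emeasure_space_1)
  finally have in_le: "(\<Sum>m\<in>W. \<integral>\<^sup>+w. \<integral>\<^sup>+v. emeasure ?N (?in w v m) \<partial>?N \<partial>?N)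
    \<le> ennreal (real c * (exp 1 * R / real n) ^ n)" .
  have "ennreal (real (card W)) = (\<Sum>m\<in>W. 1)" by (simp add: ennreal_of_nat_eq_real_of_nat)
  also have "\<dots> \<le> (\<Sum>m\<in>W. (\<integral>\<^sup>+w. \<integral>\<^sup>+v. emeasure ?N (?in w v m) \<partial>?N \<partial>?N)
       + emeasure ?N (?bk m) + emeasure ?N (?bl m) + emeasure ?N ?out)"
    by (intro sum_mono one)
  also have "\<dots> = (\<Sum>m\<in>W. \<integral>\<^sup>+w. \<integral>\<^sup>+v. emeasure ?N (?in w v m) \<partial>?N \<partial>?N)
       + (\<Sum>m\<in>W. emeasure ?N (?bk m)) + (\<Sum>m\<in>W. emeasure ?N (?bl m)) + of_nat (card W) * emeasure ?N ?out"
    by (simp add: sum.distrib)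
  also have "\<dots> \<le> ennreal (real c * (exp 1 * R / real n) ^ n) + ennreal (real (card W) / 8)
       + ennreal (real (card W) / 8) + of_nat (card W) * ennreal (1 / 4)"
    by (intro add_mono in_le ek el mult_left_mono tail) auto
  also have "\<dots> = ennreal (real c * (exp 1 * R / real n) ^ n + real (card W) / 8 + real (card W) / 8 + real (card W) * (1/4))"
    using R by (simp add: ennreal_plus[symmetric] ennreal_mult[symmetric] ennreal_of_nat_eq_real_of_nat del: ennreal_plus)
  finally have "real (card W) \<le> real c * (exp 1 * R / real n) ^ n + real (card W) / 8 + real (card W) / 8 + real (card W) * (1/4)"
    using R by (subst (asm) ennreal_le_iff) auto
  \<comment> \<open>The shares 1/8, 1/8 and 1/4 of the failure events add up to half of
    \<open>card W\<close>; moving them to the left costs the factor 2.\<close>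
  then have "real (card W) \<le> 2 * (real c * (exp 1 * R / real n) ^ n)" by linarith
  then show ?thesis by (simp add: R_def n_def mult.assoc)
qed

section \<open>Outer bound for two users of the interference channel\<close>

lemma cmod_sum_mult_power2_le:
  "(cmod (\<Sum>i\<in>A. f i * g i))\<^sup>2 \<le> (\<Sum>i\<in>A. (cmod (f i))\<^sup>2) * (\<Sum>i\<in>A. (cmod (g i))\<^sup>2)"
proof -
  have "cmod (\<Sum>i\<in>A. f i * g i) \<le> (\<Sum>i\<in>A. cmod (f i) * cmod (g i))"
    by (rule order_trans[OF norm_sum]) (simp add: norm_mult)
  then have "(cmod (\<Sum>i\<in>A. f i * g i))\<^sup>2 \<le> (\<Sum>i\<in>A. cmod (f i) * cmod (g i))\<^sup>2"
    by (intro power_mono) auto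
  also have "\<dots> \<le> (\<Sum>i\<in>A. (cmod (f i))\<^sup>2) * (\<Sum>i\<in>A. (cmod (g i))\<^sup>2)"
    by (rule Cauchy_Schwarz_ineq_sum)
  finally show ?thesis .
qed

lemma finite_slots[simp]: "finite (slots f0 t0)" by (simp add: slots_def)

lemma card_slots[simp]: "card (slots f0 t0) = f0 * t0" by (simp add: slots_def)

lemma finite_msgs[simp]: "finite (msgs M)" by (simp add: msgs_def finite_PiE)

lemma card_msgs: "card (msgs M) = (\<Prod>k<3. M k)" by (simp add: msgs_def card_PiE)

lemma rx_eq:
  "rx H f0 t0 enc m k z = (\<lambda>p\<in>slots f0 t0. (\<Sum>j<3. H (k, j, fst p) * enc j (m j) p) + z p)"
  by (auto simp: rx_def fun_eq_iff restrict_def)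

text \<open>The gain \<open>g\<close> in the proof makes the coefficient of user \<open>l\<close> in \<open>ul - g * uk\<close> vanish, so the second
  decoding step only needs the messages of user \<open>k\<close> (already decoded) and of the third user \<open>i\<close>.\<close>

lemma code_pair_bound:
  assumes hmin: "0 < hmin" and H: "\<And>k j f. hmin \<le> cmod (H (k, j, f)) \<and> cmod (H (k, j, f)) \<le> hmax"
    and code: "is_code H \<rho> f0 t0 M enc dec" and n: "5 \<le> f0 * t0" and \<rho>: "0 \<le> \<rho>"
    and kl: "k < 3" "l < 3" "k \<noteq> l"
    and ek: "err H f0 t0 M enc dec k \<le> 1 / 8" and el: "err H f0 t0 M enc dec l \<le> 1 / 8"
  shows "real (M k * M l)
    \<le> 2 * (exp 1 * (4 + 24 * hmax\<^sup>2 * hmax\<^sup>2 * \<rho> / hmin\<^sup>2)) ^ (f0 * t0)"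
proof -
  define I where "I = slots f0 t0"
  define nn where "nn = f0 * t0"
  \<comment> \<open>Since |g| \<le> \<open>hmax / hmin\<close>, this gives |g| s \<le> 1/2, so the
    shared noise fits below unit variance at receiver \<open>l\<close>; \<open>s\<close> itself is
    at most 1/2.\<close>
  define s where "s = hmin / (2 * hmax)"
  define i where "i = 3 - k - l"
  have i: "i < 3" "i \<noteq> k" "i \<noteq> l" "{..<3} = {k, l, i}"
  proof -
    have "k = 0 \<or> k = 1 \<or> k = 2" "l = 0 \<or> l = 1 \<or> l = 2" using kl by linarith+
    then show "i < 3" "i \<noteq> k" "i \<noteq> l" "{..<3} = {k, l, i}"
      using kl(3) by (auto simp: i_def numeral_3_eq_3 lessThan_Suc)
  qed
  have sum3: "(\<Sum>j<3. f j) = f k + f l + f i" for f :: "nat \<Rightarrow> complex"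
    using i kl by simp
  have hh: "hmin \<le> hmax" using H[of 0 0 0] by linarith
  have s: "0 < s" "s < 1" using hmin hh by (auto simp: s_def)
  define uk where "uk m p = (\<Sum>j<3. H (k, j, fst p) * enc j (m j) p)" for m and p :: "nat \<times> nat"
  define ul where "ul m p = (\<Sum>j<3. H (l, j, fst p) * enc j (m j) p)" for m and p :: "nat \<times> nat"
  define g where "g p = H (l, l, fst p) / H (k, l, fst p)" for p :: "nat \<times> nat"
  have N: "noise f0 t0 = gauss I" by (simp add: noise_def I_def)
  have M: "0 < M j" if "j < 3" for j using code that by (auto simp: is_code_def)
  have cM: "card (msgs M) = M k * M l * M i"
    unfolding card_msgs i(4) using i kl by simp
  have dec: "dec j \<in> measurable (PiM I (\<lambda>_. borel)) (count_space UNIV)" if "j < 3" for j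
    using code that by (auto simp: is_code_def I_def)
  have errsum: "(\<Sum>m\<in>msgs M. emeasure (gauss I) {z \<in> space (gauss I). dec j (\<lambda>p\<in>I. (\<Sum>j'<3. H (j, j', fst p) * enc j' (m j') p) + z p) \<noteq> m j})
      \<le> ennreal (real (card (msgs M)) / 8)" if j: "j < 3" "err H f0 t0 M enc dec j \<le> 1 / 8" for j
  proof -
    interpret G: prob_space "gauss I" by (rule prob_space_gauss)
    have "(\<Sum>m\<in>msgs M. emeasure (gauss I) {z \<in> space (gauss I). dec j (\<lambda>p\<in>I. (\<Sum>j'<3. H (j, j', fst p) * enc j' (m j') p) + z p) \<noteq> m j})
      = ennreal (\<Sum>m\<in>msgs M. measure (noise f0 t0) {z \<in> space (noise f0 t0). dec j (rx H f0 t0 enc m j z) \<noteq> m j})"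
      by (simp add: N rx_eq I_def[symmetric] G.emeasure_eq_measure sum_ennreal)
    also have "(\<Sum>m\<in>msgs M. measure (noise f0 t0) {z \<in> space (noise f0 t0). dec j (rx H f0 t0 enc m j z) \<noteq> m j})
        = err H f0 t0 M enc dec j * real (card (msgs M))"
    proof -
      have "real (\<Prod>j<3. M j) \<noteq> 0" using M by auto
      then show ?thesis unfolding err_def card_msgs by simp
    qed
    also have "ennreal (err H f0 t0 M enc dec j * real (card (msgs M))) \<le> ennreal (real (card (msgs M)) / 8)"
      using mult_right_mono[OF j(2), of "real (card (msgs M))"] by (intro ennreal_leI) simp
    finally show ?thesis .
  qed
  have key: "real (card (msgs M)) \<le> 2 * real (M i)
      * (exp 1 * (4 * card I + 2 * (3 * hmax\<^sup>2 * (\<rho> * real nn)) / s\<^sup>2) / real (card I)) ^ card I"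
  proof (rule two_receiver_volume_bound[where dk = "dec k" and dl = "dec l" and g = g
        and uk = uk and ul = ul and mk = "\<lambda>m. m k" and ml = "\<lambda>m. m l"])
    show "finite I" "5 \<le> card I" using n by (auto simp: I_def)
    show "0 \<le> 3 * hmax\<^sup>2 * (\<rho> * real nn)" using \<rho> by simp
    show "cmod (g p) * s < 1" if "p \<in> I" for p
    proof -
      have "cmod (g p) \<le> hmax / hmin"
        unfolding g_def norm_divide using H[of l l "fst p"] H[of k l "fst p"] hmin hh
        by (intro frac_le) auto
      then have "cmod (g p) * s \<le> hmax / hmin * s" using s by (intro mult_right_mono) auto
      also have "\<dots> = 1 / 2" using hmin hh by (simp add: s_def)
      finally show ?thesis by simp
    qed
    show "card {m \<in> msgs M. dec k y = m k \<and> dec l (\<lambda>p\<in>I. x p + (ul m p - g p * uk m p)) = m l} \<le> M i" for x y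
    proof -
      let ?S = "{m \<in> msgs M. dec k y = m k \<and> dec l (\<lambda>p\<in>I. x p + (ul m p - g p * uk m p)) = m l}"
      \<comment> \<open>All tuples in \<open>?S\<close> agree at \<open>k\<close>, where they equal
        \<open>dec k y\<close>. If they also agree at \<open>i\<close>, then
        \<open>ul - g * uk\<close> coincides, so \<open>dec l\<close> gets the same input and they
        agree at \<open>l\<close> too.\<close>
      have "inj_on (\<lambda>m. m i) ?S"
      proof (rule inj_onI)
        fix m m' assume m: "m \<in> ?S" "m' \<in> ?S" "m i = m' i"
        then have mk: "m k = m' k" by auto
        have "ul m p - g p * uk m p = ul m' p - g p * uk m' p" for p
        proof -
          have "H (k, l, fst p) \<noteq> 0" using H[of k l "fst p"] hmin by auto
          then show ?thesis using mk m(3) by (simp add: ul_def uk_def sum3 g_def field_simps)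
        qed
        then have ml: "m l = m' l" using m by simp
        have "m j = m' j" if "j < 3" for j
          using that mk ml m(3) i(4) by (metis insertE lessThan_iff singletonD)
        then show "m = m'"
          using m by (intro PiE_ext[of m "{..<3}" "\<lambda>k. {..<M k}"]) (auto simp: msgs_def)
      qed
      then have "card ?S \<le> card {..<M i}"
        using i(1) by (intro card_inj_on_le[of "\<lambda>m. m i"]) (auto simp: msgs_def)
      then show ?thesis by simp
    qed
    show "(\<Sum>p\<in>I. (cmod (uk m p))\<^sup>2) \<le> 3 * hmax\<^sup>2 * (\<rho> * real nn)" if m: "m \<in> msgs M" for m
    proof -
      have "(\<Sum>p\<in>I. (cmod (uk m p))\<^sup>2) \<le> (\<Sum>p\<in>I. 3 * hmax\<^sup>2 * (\<Sum>j<3. (cmod (enc j (m j) p))\<^sup>2))"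
      proof (rule sum_mono)
        fix p :: "nat \<times> nat"
        have "(\<Sum>j<3. (cmod (H (k, j, fst p)))\<^sup>2) \<le> (\<Sum>j<(3::nat). hmax\<^sup>2)"
          using H by (intro sum_mono power_mono) auto
        then have "(\<Sum>j<3. (cmod (H (k, j, fst p)))\<^sup>2) \<le> 3 * hmax\<^sup>2" by simp
        then show "(cmod (uk m p))\<^sup>2 \<le> 3 * hmax\<^sup>2 * (\<Sum>j<3. (cmod (enc j (m j) p))\<^sup>2)"
          unfolding uk_def
          by (intro order_trans[OF cmod_sum_mult_power2_le] mult_right_mono sum_nonneg) auto
      qed
      also have "\<dots> = 3 * hmax\<^sup>2 * (\<Sum>j<3. \<Sum>p\<in>I. (cmod (enc j (m j) p))\<^sup>2)"
        by (subst sum.swap) (simp add: sum_distrib_left)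
      also have "\<dots> \<le> 3 * hmax\<^sup>2 * (\<rho> * real nn)"
        using code m by (intro mult_left_mono) (auto simp: is_code_def I_def nn_def mult.assoc)
      finally show ?thesis .
    qed
    show "(\<Sum>m\<in>msgs M. emeasure (gauss I) {z \<in> space (gauss I). dec k (\<lambda>p\<in>I. uk m p + z p) \<noteq> m k})
      \<le> ennreal (real (card (msgs M)) / 8)"
      unfolding uk_def by (rule errsum[OF kl(1) ek])
    show "(\<Sum>m\<in>msgs M. emeasure (gauss I) {z \<in> space (gauss I). dec l (\<lambda>p\<in>I. ul m p + z p) \<noteq> m l})
      \<le> ennreal (real (card (msgs M)) / 8)"
      unfolding ul_def by (rule errsum[OF kl(2) el])
  qed (use s dec kl in auto)
  have cI: "card I = nn" by (simp add: I_def nn_def)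
  have nn: "0 < nn" using n unfolding nn_def by linarith
  \<comment> \<open>The constant 24 is 2 * 3 * 4: the 2 from the ball radius, the 3 from
    Cauchy-Schwarz over three transmitters, the 4 from 1 / s^2 = 4 hmax^2 / hmin^2.\<close>
  have "exp 1 * (4 * real nn + 2 * (3 * hmax\<^sup>2 * (\<rho> * real nn)) / s\<^sup>2) / real nn
      = exp 1 * (4 + 24 * hmax\<^sup>2 * hmax\<^sup>2 * \<rho> / hmin\<^sup>2)"
    using nn hmin hh by (simp add: s_def field_simps power2_eq_square)
  then have "real (M k * M l) * real (M i)
      \<le> (2 * (exp 1 * (4 + 24 * hmax\<^sup>2 * hmax\<^sup>2 * \<rho> / hmin\<^sup>2)) ^ nn) * real (M i)"
    using key unfolding cM cI by (simp add: mult_ac)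
  then show ?thesis
    using M[OF i(1)] unfolding nn_def by (simp only: mult_le_cancel_right of_nat_0_less_iff)
qed

text \<open>One code with error at most 1/8 and at least five slots suffices: the bound on its
  message pairs is exponential in the block length, so its logarithm per slot depends on \<rho>
  only. The summand 2 collects the factor e of the volume bound and a second e that absorbs the
  leading constant 2.\<close>

lemma achievable_pair_bound:
  assumes hmin: "0 < hmin" and H: "\<And>k j f. hmin \<le> cmod (H (k, j, f)) \<and> cmod (H (k, j, f)) \<le> hmax"
    and kl: "k < 3" "l < 3" "k \<noteq> l" and \<rho>: "1 \<le> \<rho>" and R: "achievable H \<rho> R"
  shows "R k + R l \<le> ln \<rho> + (2 + ln (4 + 24 * hmax\<^sup>2 * hmax\<^sup>2 / hmin\<^sup>2))"
proof -
  let ?C = "4 + 24 * hmax\<^sup>2 * hmax\<^sup>2 / hmin\<^sup>2"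
  have C: "0 < ?C" by (intro add_pos_nonneg) auto
  have \<rho>0: "0 < \<rho>" using \<rho> by linarith
  from R obtain f0 t0 M enc dec where n: "5 \<le> f0 * t0" and code: "is_code H \<rho> f0 t0 M enc dec"
    and RM: "\<And>j. j < 3 \<Longrightarrow> R j \<le> ln (real (M j)) / (real f0 * real t0)"
    and er: "\<And>j. j < 3 \<Longrightarrow> err H f0 t0 M enc dec j \<le> 1 / 8"
    unfolding achievable_def by (metis zero_less_divide_1_iff zero_less_numeral)
  let ?n = "f0 * t0"
  have n0: "0 < real f0 * real t0" using n by (cases "f0 = 0 \<or> t0 = 0") auto
  have M: "0 < M j" if "j < 3" for j using code that by (auto simp: is_code_def)
  have "real (M k * M l) \<le> 2 * (exp 1 * (4 + 24 * hmax\<^sup>2 * hmax\<^sup>2 * \<rho> / hmin\<^sup>2)) ^ ?n"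
    using code_pair_bound[OF hmin H code n _ kl] er kl \<rho> by simp
  also have "\<dots> \<le> 2 * (exp 1 * (?C * \<rho>)) ^ ?n"
    using \<rho> by (intro mult_left_mono power_mono) (auto simp: field_simps)
  also have "\<dots> \<le> exp 1 ^ ?n * (exp 1 * (?C * \<rho>)) ^ ?n"
  proof -
    have "(2::real) \<le> exp 1" using exp_ge_add_one_self[of 1] by simp
    also have "\<dots> = exp 1 ^ 1" by simp
    also have "\<dots> \<le> exp 1 ^ ?n" using n0 by (intro power_increasing) (auto simp: Suc_le_eq zero_less_mult_iff)
    finally show ?thesis using C \<rho> by (intro mult_right_mono) auto
  qed
  also have "\<dots> = (exp 2 * ?C * \<rho>) ^ ?n"
  proof -
    have "exp (2::real) = exp 1 * exp 1" by (simp flip: exp_add)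
    then show ?thesis by (simp add: power_mult_distrib mult.assoc)
  qed
  finally have "ln (real (M k * M l)) \<le> ln ((exp 2 * ?C * \<rho>) ^ ?n)"
    using M[OF kl(1)] M[OF kl(2)] by (subst ln_le_cancel_iff) (auto intro!: zero_less_power mult_pos_pos simp: C \<rho>0)
  also have "\<dots> = real f0 * real t0 * (2 + ln ?C + ln \<rho>)"
    using C \<rho> by (simp add: ln_realpow ln_mult)
  finally have "ln (real (M k)) + ln (real (M l)) \<le> real f0 * real t0 * (2 + ln ?C + ln \<rho>)"
    using M[OF kl(1)] M[OF kl(2)] by (simp add: ln_mult)
  then have "ln (real (M k)) / (real f0 * real t0) + ln (real (M l)) / (real f0 * real t0) \<le> 2 + ln ?C + ln \<rho>"
    using n0 by (simp add: add_divide_distrib[symmetric] divide_le_eq mult.commute)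
  then show ?thesis using RM[OF kl(1)] RM[OF kl(2)] by linarith
qed

section \<open>Packing Gaussian integer vectors\<close>

text \<open>Gilbert-Varshamov argument: in a largest set of pairwise far points no point can be
  added, so the neighbourhoods of its points cover \<open>X\<close>.\<close>

lemma exists_packing:
  fixes near :: "'a \<Rightarrow> 'a \<Rightarrow> bool" and b :: real
  assumes "finite X" and refl: "\<And>x. x \<in> X \<Longrightarrow> near x x"
    and sym: "\<And>x y. near x y \<Longrightarrow> near y x"
    and b: "\<And>x. x \<in> X \<Longrightarrow> real (card {y \<in> X. near x y}) \<le> b"
  obtains C where "C \<subseteq> X" "\<And>x y. x \<in> C \<Longrightarrow> y \<in> C \<Longrightarrow> x \<noteq> y \<Longrightarrow> \<not> near x y"
    "real (card X) \<le> real (card C) * b"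
proof -
  define F where "F = {C. C \<subseteq> X \<and> (\<forall>x\<in>C. \<forall>y\<in>C. x \<noteq> y \<longrightarrow> \<not> near x y)}"
  have "finite F" unfolding F_def using assms(1) by (auto intro: finite_subset[of _ "Pow X"])
  moreover have "{} \<in> F" by (auto simp: F_def)
  ultimately have "Max (card ` F) \<in> card ` F" by (intro Max_in) auto
  then obtain C where C: "C \<in> F" and "card C = Max (card ` F)" by auto
  with \<open>finite F\<close> have maxC: "card C' \<le> card C" if "C' \<in> F" for C'
    using that by simp
  have CX: "C \<subseteq> X" "finite C" using C assms(1) by (auto simp: F_def intro: finite_subset)
  have "X \<subseteq> (\<Union>c\<in>C. {y \<in> X. near c y})"
  proof
    fix y assume y: "y \<in> X"
    show "y \<in> (\<Union>c\<in>C. {y \<in> X. near c y})"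
    proof (rule ccontr)
      assume far: "y \<notin> (\<Union>c\<in>C. {y \<in> X. near c y})"
      then have "y \<notin> C" using refl y by auto
      moreover have "insert y C \<in> F" using far C y sym by (auto simp: F_def)
      ultimately show False using maxC[of "insert y C"] CX by simp
    qed
  qed
  then have "card X \<le> card (\<Union>c\<in>C. {y \<in> X. near c y})"
    using CX assms(1) by (intro card_mono) auto
  also have "\<dots> \<le> (\<Sum>c\<in>C. card {y \<in> X. near c y})" by (rule card_UN_le[OF CX(2)])
  finally have "real (card X) \<le> (\<Sum>c\<in>C. real (card {y \<in> X. near c y}))"
    by (metis of_nat_le_iff of_nat_sum)
  also have "\<dots> \<le> (\<Sum>c\<in>C. b)" using CX b by (intro sum_mono) auto
  finally have "real (card X) \<le> real (card C) * b" by simp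
  with C that show ?thesis by (auto simp: F_def)
qed

text \<open>A square constellation of Q^2 symbols. It is not centred at zero; the squared moduli are
  still of order Q^2, and a constant factor in power is a bounded loss of rate.\<close>

definition gauss_box :: "nat \<Rightarrow> complex set" where
  "gauss_box Q = (\<lambda>(a, b). Complex (real a) (real b)) ` ({..<Q} \<times> {..<Q})"

lemma inj_gauss_box: "inj_on (\<lambda>(a, b). Complex (real a) (real b)) A"
  by (auto simp: inj_on_def)

lemma finite_gauss_box[simp]: "finite (gauss_box Q)" by (simp add: gauss_box_def)

lemma card_gauss_box: "card (gauss_box Q) = Q\<^sup>2"
  by (simp add: gauss_box_def card_image[OF inj_gauss_box] card_cartesian_product power2_eq_square)

lemma gauss_box_norm_le:
  assumes "x \<in> gauss_box Q"
  shows "(cmod x)\<^sup>2 \<le> 2 * (real Q)\<^sup>2"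
proof -
  obtain a b where ab: "a < Q" "b < Q" "x = Complex (real a) (real b)"
    using assms by (auto simp: gauss_box_def)
  then have "(real a)\<^sup>2 \<le> (real Q)\<^sup>2" "(real b)\<^sup>2 \<le> (real Q)\<^sup>2"
    by (auto intro!: power_mono)
  then have "(real a)\<^sup>2 + (real b)\<^sup>2 \<le> 2 * (real Q)\<^sup>2" by linarith
  then show ?thesis using ab by (simp add: cmod_power2)
qed

lemma sum_half_power_inj_le:
  assumes "finite A" "inj_on h A"
  shows "(\<Sum>a\<in>A. (1 / 2 :: real) ^ h a) \<le> 2"
proof -
  have "(\<Sum>a\<in>A. (1 / 2 :: real) ^ h a) = (\<Sum>d\<in>h ` A. (1 / 2) ^ d)"
    by (simp add: sum.reindex[OF assms(2)])
  also have "\<dots> \<le> (\<Sum>d. (1 / 2) ^ d)"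
    using assms by (intro sum_le_suminf) auto
  also have "\<dots> = 2" by (subst suminf_geometric) auto
  finally show ?thesis .
qed

text \<open>For a natural number d one has d \<le> d^2, and e \<ge> 2, so the terms on either side
  of \<open>b\<close> are dominated by a geometric series of sum 2. The bound does not depend on
  \<open>A\<close> or \<open>b\<close>.\<close>

lemma sum_exp_neg_square_le:
  assumes "finite A"
  shows "(\<Sum>a\<in>A. exp (- (real a - real b)\<^sup>2)) \<le> 4"
proof -
  have e: "exp (- (real a - real b)\<^sup>2) \<le> (1 / 2) ^ (if a \<le> b then b - a else a - b)" for a
  proof -
    define d where "d = (if a \<le> b then b - a else a - b)"
    have d: "(real a - real b)\<^sup>2 = (real d)\<^sup>2" by (auto simp: d_def of_nat_diff power2_commute)
    have "d \<le> d\<^sup>2" by (cases d) (auto simp: power2_eq_square)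
    then have "real d \<le> (real d)\<^sup>2" by (metis of_nat_le_iff of_nat_power)
    then have "exp (- (real d)\<^sup>2) \<le> exp (- real d)" by simp
    also have "\<dots> = exp (- 1) ^ d" by (simp add: exp_of_nat_mult[symmetric])
    also have "\<dots> \<le> (1 / 2) ^ d"
    proof (intro power_mono)
      have "(2::real) \<le> exp 1" using exp_ge_add_one_self[of "1::real"] by simp
      then show "exp (- 1) \<le> (1 / 2 :: real)" by (simp add: exp_minus field_simps)
    qed simp
    finally show ?thesis unfolding d by (simp add: d_def)
  qed
  have "(\<Sum>a\<in>A. exp (- (real a - real b)\<^sup>2)) \<le> (\<Sum>a\<in>A. (1 / 2) ^ (if a \<le> b then b - a else a - b))"
    by (intro sum_mono e)
  also have "\<dots> = (\<Sum>a\<in>{a \<in> A. a \<le> b}. (1 / 2) ^ (b - a)) + (\<Sum>a\<in>{a \<in> A. \<not> a \<le> b}. (1 / 2) ^ (a - b))"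
    using assms by (simp add: if_distrib[of "\<lambda>d. (1 / 2 :: real) ^ d"] sum.If_cases Int_def cong: if_cong)
  also have "\<dots> \<le> 2 + 2"
    using assms by (intro add_mono sum_half_power_inj_le) (auto simp: inj_on_def)
  finally show ?thesis by simp
qed

lemma sum_gauss_box_le:
  assumes "x \<in> gauss_box Q"
  shows "(\<Sum>s\<in>gauss_box Q. exp (- (cmod (s - x))\<^sup>2)) \<le> 16"
proof -
  obtain a b where x: "x = Complex (real a) (real b)"
    using assms by (auto simp: gauss_box_def)
  have "(\<Sum>s\<in>gauss_box Q. exp (- (cmod (s - x))\<^sup>2))
    = (\<Sum>(a', b')\<in>{..<Q} \<times> {..<Q}. exp (- (real a' - real a)\<^sup>2) * exp (- (real b' - real b)\<^sup>2))"
    unfolding gauss_box_def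
    by (subst sum.reindex[OF inj_gauss_box])
      (auto intro!: sum.cong simp: x cmod_power2 exp_add[symmetric])
  also have "\<dots> = (\<Sum>a'<Q. exp (- (real a' - real a)\<^sup>2)) * (\<Sum>b'<Q. exp (- (real b' - real b)\<^sup>2))"
    by (simp add: sum_product sum.cartesian_product)
  also have "\<dots> \<le> 4 * 4"
    by (intro mult_mono sum_exp_neg_square_le sum_nonneg) auto
  finally show ?thesis by simp
qed

text \<open>Discrete version of the ball volume estimate: the indicator is at most
  \<open>exp (r - dist)\<close> for the squared distance, and the sum over the box factors into
  coordinates, each contributing at most 16. What matters is that \<open>Q\<close> does not occur,
  so a prescribed distance costs a rate independent of the power.\<close>

lemma gauss_box_ball_card_le:
  assumes J: "finite J" and x: "x \<in> PiE J (\<lambda>_. gauss_box Q)"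
  shows "real (card {y \<in> PiE J (\<lambda>_. gauss_box Q). (\<Sum>p\<in>J. (cmod (y p - x p))\<^sup>2) \<le> r})
    \<le> exp r * 16 ^ card J"
proof -
  let ?X = "PiE J (\<lambda>_. gauss_box Q)"
  have fin: "finite ?X" using J by (intro finite_PiE) auto
  have "real (card {y \<in> ?X. (\<Sum>p\<in>J. (cmod (y p - x p))\<^sup>2) \<le> r})
     = (\<Sum>y\<in>{y \<in> ?X. (\<Sum>p\<in>J. (cmod (y p - x p))\<^sup>2) \<le> r}. 1)" by simp
  also have "\<dots> \<le> (\<Sum>y\<in>{y \<in> ?X. (\<Sum>p\<in>J. (cmod (y p - x p))\<^sup>2) \<le> r}. exp (r - (\<Sum>p\<in>J. (cmod (y p - x p))\<^sup>2)))"
    by (intro sum_mono) auto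
  also have "\<dots> \<le> (\<Sum>y\<in>?X. exp (r - (\<Sum>p\<in>J. (cmod (y p - x p))\<^sup>2)))"
    using fin by (intro sum_mono2) auto
  also have "\<dots> = exp r * (\<Sum>y\<in>?X. \<Prod>p\<in>J. exp (- (cmod (y p - x p))\<^sup>2))"
    using J by (simp add: sum_distrib_left exp_diff exp_sum prod_inversef[symmetric] exp_minus divide_inverse)
  also have "(\<Sum>y\<in>?X. \<Prod>p\<in>J. exp (- (cmod (y p - x p))\<^sup>2)) = (\<Prod>p\<in>J. \<Sum>s\<in>gauss_box Q. exp (- (cmod (s - x p))\<^sup>2))"
    using J by (subst prod_sum_PiE) auto
  also have "exp r * \<dots> \<le> exp r * (\<Prod>p\<in>J. 16)"
    using x by (intro mult_left_mono prod_mono conjI sum_nonneg sum_gauss_box_le) auto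
  finally show ?thesis by simp
qed

lemma exists_gauss_box_code:
  assumes J: "finite J" and r: "0 \<le> r"
  obtains C where "C \<subseteq> PiE J (\<lambda>_. gauss_box Q)"
    "\<And>x y. x \<in> C \<Longrightarrow> y \<in> C \<Longrightarrow> x \<noteq> y \<Longrightarrow> r < (\<Sum>p\<in>J. (cmod (y p - x p))\<^sup>2)"
    "real Q ^ (2 * card J) \<le> real (card C) * (exp r * 16 ^ card J)"
proof (rule exists_packing[of "PiE J (\<lambda>_. gauss_box Q)" "\<lambda>x y. (\<Sum>p\<in>J. (cmod (y p - x p))\<^sup>2) \<le> r" "exp r * 16 ^ card J"])
  fix C assume C: "C \<subseteq> PiE J (\<lambda>_. gauss_box Q)"
    "\<And>x y. x \<in> C \<Longrightarrow> y \<in> C \<Longrightarrow> x \<noteq> y \<Longrightarrow> \<not> (\<Sum>p\<in>J. (cmod (y p - x p))\<^sup>2) \<le> r"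
    "real (card (PiE J (\<lambda>_. gauss_box Q))) \<le> real (card C) * (exp r * 16 ^ card J)"
  show thesis
  proof (rule that[OF C(1)])
    show "real Q ^ (2 * card J) \<le> real (card C) * (exp r * 16 ^ card J)"
      using C(3) J by (simp add: card_PiE card_gauss_box power_mult)
    show "r < (\<Sum>p\<in>J. (cmod (y p - x p))\<^sup>2)" if "x \<in> C" "y \<in> C" "x \<noteq> y" for x y
      using C(2)[OF that] by simp
  qed
qed (use J r gauss_box_ball_card_le[OF J] in \<open>auto intro!: finite_PiE simp: norm_minus_commute\<close>)

section \<open>Zero-forcing schemes\<close>

lemma gauss_tail_eventually_small:
  assumes "0 < \<epsilon>"
  obtains T where "\<And>n. T \<le> n \<Longrightarrow> (2 / exp 1 :: real) ^ n \<le> \<epsilon>"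
proof -
  have "(2 / exp 1 :: real) < 1"
    using exp_ge_add_one_self[of "1::real"] abs_diff_le_iff[THEN iffD1, OF e_approx_32] by simp
  then have "(\<lambda>n. (2 / exp 1 :: real) ^ n) \<longlonglongrightarrow> 0" by (intro LIMSEQ_realpow_zero) auto
  then have "eventually (\<lambda>n. (2 / exp 1 :: real) ^ n < \<epsilon>) sequentially"
    using assms by (rule order_tendstoD)
  then show ?thesis using that unfolding eventually_sequentially by (metis less_imp_le)
qed

text \<open>Reduces the error analysis to a deterministic statement: decoding has to be right
  whenever the squared norm of the noise is below twice the number of slots.\<close>

lemma err_le_tail:
  assumes M: "\<forall>k<3. 0 < M k"
    and dec: "dec k \<in> measurable (PiM (slots f0 t0) (\<lambda>_. borel)) (count_space UNIV)"
    and correct: "\<And>m z. m \<in> msgs M \<Longrightarrow> (\<Sum>p\<in>slots f0 t0. (cmod (z p))\<^sup>2) < 2 * real (f0 * t0)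
      \<Longrightarrow> dec k (rx H f0 t0 enc m k z) = m k"
  shows "err H f0 t0 M enc dec k \<le> (2 / exp 1) ^ (f0 * t0)"
proof -
  let ?N = "noise f0 t0"
  interpret N: prob_space ?N unfolding noise_def by (rule prob_space_gauss)
  have "(\<Sum>m\<in>msgs M. measure ?N {z \<in> space ?N. dec k (rx H f0 t0 enc m k z) \<noteq> m k})
     \<le> (\<Sum>m\<in>msgs M. (2 / exp 1) ^ (f0 * t0))"
  proof (rule sum_mono)
    fix m assume m: "m \<in> msgs M"
    have "measure ?N {z \<in> space ?N. dec k (rx H f0 t0 enc m k z) \<noteq> m k}
      \<le> measure ?N {z \<in> space ?N. 2 * real (card (slots f0 t0)) \<le> (\<Sum>p\<in>slots f0 t0. (cmod (z p))\<^sup>2)}"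
    proof (rule N.finite_measure_mono)
      show "{z \<in> space ?N. dec k (rx H f0 t0 enc m k z) \<noteq> m k}
        \<subseteq> {z \<in> space ?N. 2 * real (card (slots f0 t0)) \<le> (\<Sum>p\<in>slots f0 t0. (cmod (z p))\<^sup>2)}"
        using correct[OF m] by (auto simp: not_less[symmetric])
      show "{z \<in> space ?N. 2 * real (card (slots f0 t0)) \<le> (\<Sum>p\<in>slots f0 t0. (cmod (z p))\<^sup>2)} \<in> sets ?N"
        unfolding noise_def by measurable
    qed
    also have "\<dots> \<le> (2 / exp 1) ^ (f0 * t0)"
      using emeasure_gauss_tail[OF finite_slots[of f0 t0]] unfolding noise_def[symmetric] N.emeasure_eq_measure
      by (subst (asm) ennreal_le_iff) auto
    finally show "measure ?N {z \<in> space ?N. dec k (rx H f0 t0 enc m k z) \<noteq> m k} \<le> (2 / exp 1) ^ (f0 * t0)" .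
  qed
  also have "\<dots> = (2 / exp 1) ^ (f0 * t0) * real (\<Prod>j<3. M j)"
    by (simp add: card_msgs)
  finally show ?thesis
    unfolding err_def using M by (subst pos_divide_le_eq) (auto intro!: prod_pos)
qed

lemma sum_norm_add_power2_le:
  "(\<Sum>p\<in>J. (cmod (a p - b p))\<^sup>2) \<le> 2 * (\<Sum>p\<in>J. (cmod (y p - a p))\<^sup>2) + 2 * (\<Sum>p\<in>J. (cmod (y p - b p))\<^sup>2)"
proof -
  have "(cmod (a p - b p))\<^sup>2 \<le> 2 * (cmod (y p - a p))\<^sup>2 + 2 * (cmod (y p - b p))\<^sup>2" for p
  proof -
    have "cmod (a p - b p) \<le> cmod (y p - a p) + cmod (y p - b p)"
      using norm_triangle_ineq4[of "y p - b p" "y p - a p"] by (simp add: add.commute)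
    then have "(cmod (a p - b p))\<^sup>2 \<le> (cmod (y p - a p) + cmod (y p - b p))\<^sup>2"
      by (intro power_mono) auto
    also have "\<dots> \<le> 2 * (cmod (y p - a p))\<^sup>2 + 2 * (cmod (y p - b p))\<^sup>2"
      using zero_le_power2[of "cmod (y p - a p) - cmod (y p - b p)"]
      by (simp add: power2_sum power2_diff)
    finally show ?thesis .
  qed
  then have "(\<Sum>p\<in>J. (cmod (a p - b p))\<^sup>2) \<le> (\<Sum>p\<in>J. 2 * (cmod (y p - a p))\<^sup>2 + 2 * (cmod (y p - b p))\<^sup>2)"
    by (rule sum_mono)
  then show ?thesis by (simp add: sum.distrib sum_distrib_left)
qed

lemma sum_slots_product:
  "(\<Sum>p\<in>slots f0 t0. h p) = (\<Sum>f<f0. \<Sum>t<t0. h (f, t))"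
  unfolding slots_def by (simp add: sum.cartesian_product)

text \<open>\<open>V j f i\<close> is the entry of the \<open>i\<close>-th beam of transmitter
  \<open>j\<close> at frequency \<open>f\<close>, and \<open>U k i\<close> is the receive filter for
  stream \<open>i\<close> of user \<open>k\<close>. Assumption \<open>zf\<close> says that each
  filter passes its stream with gain 1 and removes all others, so \<open>f0\<close> frequencies
  carry \<open>d k\<close> clean parallel channels for user \<open>k\<close>. As the channel is
  constant in time, the same beams serve every time slot.\<close>

locale linear_scheme =
  fixes H :: "nat \<times> nat \<times> nat \<Rightarrow> complex" and f0 :: nat and d :: "nat \<Rightarrow> nat"
    and V U :: "nat \<Rightarrow> nat \<Rightarrow> nat \<Rightarrow> complex"
  assumes f0: "0 < f0"
    and zf: "\<And>k j i i'. k < 3 \<Longrightarrow> j < 3 \<Longrightarrow> i < d k \<Longrightarrow> i' < d j \<Longrightarrow>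
      (\<Sum>f<f0. U k i f * (H (k, j, f) * V j f i')) = (if k = j \<and> i = i' then 1 else 0)"
begin

text \<open>Total squared norm of the receive filters, which bounds the noise amplification by
  Cauchy-Schwarz.\<close>

definition "gain = (\<Sum>k<3. \<Sum>i<d k. \<Sum>f<f0. (cmod (U k i f))\<^sup>2)"

definition "num_streams = (\<Sum>k<3. d k)"

text \<open>Chosen so that symbols from \<open>gauss_box Q\<close> use total energy at most
  \<open>energy * Q^2\<close> per time slot: the factor 2 is the symbol bound 2 Q^2, and
  \<open>num_streams\<close> bounds the number of symbols superposed by one user.\<close>

definition "energy = (\<Sum>k<3. \<Sum>f<f0. \<Sum>i<d k. (cmod (V k f i))\<^sup>2) * (2 * real num_streams)"

definition encode :: "(nat \<Rightarrow> nat \<Rightarrow> nat \<times> nat \<Rightarrow> complex) \<Rightarrow> nat \<Rightarrow> nat \<Rightarrow> nat \<times> nat \<Rightarrow> complex" where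
  "encode cw k m p = (\<Sum>i<d k. V k (fst p) i * cw k m (i, snd p))"

definition zero_force :: "nat \<Rightarrow> (nat \<times> nat \<Rightarrow> complex) \<Rightarrow> nat \<times> nat \<Rightarrow> complex" where
  "zero_force k y q = (\<Sum>f<f0. U k (fst q) f * y (f, snd q))"

text \<open>The alternative \<open>m = M k\<close> is the answer when no codeword is near; it keeps the \<open>LEAST\<close> well defined.\<close>

definition decode :: "(nat \<Rightarrow> nat) \<Rightarrow> (nat \<Rightarrow> nat \<Rightarrow> nat \<times> nat \<Rightarrow> complex) \<Rightarrow> real \<Rightarrow> nat \<Rightarrow> nat
    \<Rightarrow> (nat \<times> nat \<Rightarrow> complex) \<Rightarrow> nat" where
  "decode M cw r t0 k y = (LEAST m. m = M k \<or>
     (\<Sum>q\<in>{..<d k} \<times> {..<t0}. (cmod (zero_force k y q - cw k m q))\<^sup>2) \<le> r / 4)"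

lemma d_le_num_streams:
  assumes "k < 3"
  shows "d k \<le> num_streams"
  unfolding num_streams_def by (rule member_le_sum) (use assms in auto)

lemma gain_nonneg: "0 \<le> gain"
  unfolding gain_def by (intro sum_nonneg) auto

lemma energy_nonneg: "0 \<le> energy"
  unfolding energy_def by (intro mult_nonneg_nonneg sum_nonneg) auto

lemma zero_force_rx:
  assumes k: "k < 3" and q: "q \<in> {..<d k} \<times> {..<t0}"
  shows "zero_force k (rx H f0 t0 (encode cw) m k z) q = cw k (m k) q + zero_force k z q"
proof -
  obtain i t where it: "q = (i, t)" "i < d k" "t < t0" using q by auto
  have "zero_force k (rx H f0 t0 (encode cw) m k z) q
    = (\<Sum>f<f0. U k i f * ((\<Sum>j<3. H (k, j, f) * (\<Sum>i'<d j. V j f i' * cw j (m j) (i', t))) + z (f, t)))"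
    unfolding zero_force_def it by (rule sum.cong) (auto simp: rx_eq slots_def it encode_def)
  also have "\<dots> = (\<Sum>f<f0. \<Sum>j<3. \<Sum>i'<d j. U k i f * (H (k, j, f) * V j f i') * cw j (m j) (i', t))
      + zero_force k z q"
    by (simp add: zero_force_def it distrib_left sum.distrib sum_distrib_left mult.assoc)
  also have "(\<Sum>f<f0. \<Sum>j<3. \<Sum>i'<d j. U k i f * (H (k, j, f) * V j f i') * cw j (m j) (i', t))
    = (\<Sum>j<3. \<Sum>i'<d j. (\<Sum>f<f0. U k i f * (H (k, j, f) * V j f i')) * cw j (m j) (i', t))"
    by (subst sum.swap, rule sum.cong[OF refl], subst sum.swap) (simp add: sum_distrib_right)
  also have "\<dots> = (\<Sum>j<3. \<Sum>i'<d j. if j = k then (if i' = i then cw k (m k) (i, t) else 0) else 0)"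
    using k it by (intro sum.cong refl) (auto simp: zf)
  also have "\<dots> = (\<Sum>j<3. if j = k then (\<Sum>i'<d j. if i' = i then cw k (m k) (i, t) else 0) else 0)"
    by (intro sum.cong) auto
  also have "\<dots> = cw k (m k) q"
    using k it by (simp add: sum.delta)
  finally show ?thesis .
qed

lemma zero_force_norm_le:
  assumes k: "k < 3"
  shows "(\<Sum>q\<in>{..<d k} \<times> {..<t0}. (cmod (zero_force k z q))\<^sup>2) \<le> gain * (\<Sum>p\<in>slots f0 t0. (cmod (z p))\<^sup>2)"
proof -
  have "(\<Sum>q\<in>{..<d k} \<times> {..<t0}. (cmod (zero_force k z q))\<^sup>2)
    \<le> (\<Sum>(i, t)\<in>{..<d k} \<times> {..<t0}. (\<Sum>f<f0. (cmod (U k i f))\<^sup>2) * (\<Sum>f<f0. (cmod (z (f, t)))\<^sup>2))"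
    unfolding zero_force_def case_prod_beta by (intro sum_mono cmod_sum_mult_power2_le)
  also have "\<dots> = (\<Sum>i<d k. \<Sum>f<f0. (cmod (U k i f))\<^sup>2) * (\<Sum>t<t0. \<Sum>f<f0. (cmod (z (f, t)))\<^sup>2)"
  proof -
    have "(\<Sum>(i, t)\<in>A \<times> B. F i * G t) = sum F A * sum G B" for F G :: "nat \<Rightarrow> real" and A B
      by (simp add: sum_product sum.cartesian_product)
    then show ?thesis .
  qed
  also have "(\<Sum>t<t0. \<Sum>f<f0. (cmod (z (f, t)))\<^sup>2) = (\<Sum>p\<in>slots f0 t0. (cmod (z p))\<^sup>2)"
    unfolding sum_slots_product by (rule sum.swap)
  also have "(\<Sum>i<d k. \<Sum>f<f0. (cmod (U k i f))\<^sup>2) * (\<Sum>p\<in>slots f0 t0. (cmod (z p))\<^sup>2)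
     \<le> gain * (\<Sum>p\<in>slots f0 t0. (cmod (z p))\<^sup>2)"
    unfolding gain_def using k
    by (intro mult_right_mono member_le_sum[of k "{..<3}" "\<lambda>k. \<Sum>i<d k. \<Sum>f<f0. (cmod (U k i f))\<^sup>2"] sum_nonneg) auto
  finally show ?thesis .
qed

lemma encode_power_le:
  assumes cw: "\<And>k q. k < 3 \<Longrightarrow> q \<in> {..<d k} \<times> {..<t0} \<Longrightarrow> (cmod (cw k (m k) q))\<^sup>2 \<le> 2 * (real Q)\<^sup>2"
  shows "(\<Sum>k<3. \<Sum>p\<in>slots f0 t0. (cmod (encode cw k (m k) p))\<^sup>2) \<le> energy * (real Q)\<^sup>2 * real t0"
proof -
  have "(\<Sum>k<3. \<Sum>p\<in>slots f0 t0. (cmod (encode cw k (m k) p))\<^sup>2)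
     \<le> (\<Sum>k<3. \<Sum>p\<in>slots f0 t0. (\<Sum>i<d k. (cmod (V k (fst p) i))\<^sup>2) * (2 * real num_streams * (real Q)\<^sup>2))"
  proof (intro sum_mono)
    fix k p assume k: "k \<in> {..<3::nat}" and p: "p \<in> slots f0 t0"
    have "(\<Sum>i<d k. (cmod (cw k (m k) (i, snd p)))\<^sup>2) \<le> (\<Sum>i<d k. 2 * (real Q)\<^sup>2)"
      using p k by (intro sum_mono cw) (auto simp: slots_def)
    also have "\<dots> = real (d k) * (2 * (real Q)\<^sup>2)" by simp
    also have "\<dots> \<le> real num_streams * (2 * (real Q)\<^sup>2)"
      using k d_le_num_streams[of k] by (intro mult_right_mono) auto
    finally have "(\<Sum>i<d k. (cmod (cw k (m k) (i, snd p)))\<^sup>2) \<le> 2 * real num_streams * (real Q)\<^sup>2" by simp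
    then show "(cmod (encode cw k (m k) p))\<^sup>2
        \<le> (\<Sum>i<d k. (cmod (V k (fst p) i))\<^sup>2) * (2 * real num_streams * (real Q)\<^sup>2)"
      unfolding encode_def
      by (intro order_trans[OF cmod_sum_mult_power2_le] mult_left_mono sum_nonneg) auto
  qed
  also have "\<dots> = energy * (real Q)\<^sup>2 * real t0"
    by (simp add: sum_slots_product energy_def sum_distrib_right sum_distrib_left mult_ac)
  finally show ?thesis .
qed

lemma decode_measurable:
  "decode M cw r t0 k \<in> measurable (PiM (slots f0 t0) (\<lambda>_. borel)) (count_space UNIV)"
proof -
  have [measurable]: "(\<lambda>y. y (f, t)) \<in> borel_measurable (PiM (slots f0 t0) (\<lambda>_. borel :: complex measure))"
    if "f < f0" "t < t0" for f t
    using that by (intro measurable_component_singleton) (auto simp: slots_def)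
  have [measurable]: "(\<lambda>y. \<Sum>q\<in>{..<d k} \<times> {..<t0}. (cmod (zero_force k y q - cw k m q))\<^sup>2)
      \<in> borel_measurable (PiM (slots f0 t0) (\<lambda>_. borel))" for m
    unfolding zero_force_def by (rule borel_measurable_sum) auto
  show ?thesis
    unfolding decode_def[abs_def] by measurable
qed

text \<open>If two codewords were within squared distance r/4 of the filtered output, their own
  squared distance would be at most 2 (r/4) + 2 (r/4) = r, against the separation. For
  \<open>LEAST\<close> only the messages below the true one have to be excluded.\<close>

lemma decode_correct:
  assumes k: "k < 3" and m: "m k < M k"
    and sep: "\<And>m'. m' < M k \<Longrightarrow> m' \<noteq> m k \<Longrightarrow>
       r < (\<Sum>q\<in>{..<d k} \<times> {..<t0}. (cmod (cw k (m k) q - cw k m' q))\<^sup>2)"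
    and z: "gain * (\<Sum>p\<in>slots f0 t0. (cmod (z p))\<^sup>2) \<le> r / 4"
  shows "decode M cw r t0 k (rx H f0 t0 (encode cw) m k z) = m k"
proof -
  let ?J = "{..<d k} \<times> {..<t0}"
  let ?y = "zero_force k (rx H f0 t0 (encode cw) m k z)"
  have near: "(\<Sum>q\<in>?J. (cmod (?y q - cw k (m k) q))\<^sup>2) \<le> r / 4"
  proof -
    have "(\<Sum>q\<in>?J. (cmod (?y q - cw k (m k) q))\<^sup>2) = (\<Sum>q\<in>?J. (cmod (zero_force k z q))\<^sup>2)"
      by (rule sum.cong[OF refl]) (simp only: zero_force_rx[OF k] add_diff_cancel_left')
    then show ?thesis using zero_force_norm_le[OF k, of z t0] z by linarith
  qed
  have far: "\<not> (\<Sum>q\<in>?J. (cmod (?y q - cw k m' q))\<^sup>2) \<le> r / 4" if m': "m' < m k" for m'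
  proof -
    have "r < (\<Sum>q\<in>?J. (cmod (cw k (m k) q - cw k m' q))\<^sup>2)"
      using sep[of m'] m m' by linarith
    then show ?thesis
      using near sum_norm_add_power2_le[of "cw k (m k)" "cw k m'" ?J ?y] by linarith
  qed
  show ?thesis
    unfolding decode_def
  proof (rule Least_equality)
    fix m' assume m': "m' = M k \<or> (\<Sum>q\<in>?J. (cmod (?y q - cw k m' q))\<^sup>2) \<le> r / 4"
    show "m k \<le> m'"
      using m' far[of m'] m by (cases "m' < m k") auto
  qed (use near in simp)
qed

lemma linear_scheme_rates:
  obtains c where "\<And>\<rho>. energy + 1 \<le> \<rho> \<Longrightarrow> achievable H \<rho> (\<lambda>k. max 0 (real (d k) / real f0 * ln \<rho> - c))"
proof
  \<comment> \<open>Here 64 = 4 * 16, with 4 from rounding the amplitude down to the integer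
    \<open>Q\<close> and 16 from the count of neighbours in the box. The term
    \<open>8 * (gain + 1)\<close> is the logarithm of \<open>exp r\<close> per slot.\<close>
  let ?c = "real num_streams * ln (64 * (energy + 1)) + 8 * (gain + 1)"
  fix \<rho> assume \<rho>: "energy + 1 \<le> \<rho>"
  have \<rho>0: "0 < \<rho>" using \<rho> energy_nonneg by linarith
  \<comment> \<open>The largest amplitude compatible with the power, up to replacing
    \<open>energy\<close> by \<open>energy + 1\<close> to avoid a zero denominator. The assumption
    on \<rho> gives \<open>1 \<le> x\<close>, hence a nonempty box.\<close>
  define x where "x = sqrt (\<rho> / (energy + 1))"
  have x: "1 \<le> x" "x\<^sup>2 = \<rho> / (energy + 1)" using \<rho> energy_nonneg by (auto simp: x_def)
  define Q where "Q = nat \<lfloor>x\<rfloor>"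
  have Q: "1 \<le> Q" "real Q \<le> x" "x \<le> 2 * real Q"
  proof -
    have "1 \<le> \<lfloor>x\<rfloor>" using x(1) by simp
    moreover from this have "real Q = of_int \<lfloor>x\<rfloor>" by (simp add: Q_def)
    ultimately show "1 \<le> Q" "real Q \<le> x" "x \<le> 2 * real Q"
      unfolding Q_def by linarith+
  qed
  have Qpow: "energy * (real Q)\<^sup>2 \<le> \<rho>"
  proof -
    have "energy * (real Q)\<^sup>2 \<le> (energy + 1) * x\<^sup>2"
      using energy_nonneg Q by (intro mult_mono power_mono) auto
    then show ?thesis using x energy_nonneg by simp
  qed
  have Qlow: "\<rho> / (4 * (energy + 1)) \<le> (real Q)\<^sup>2"
  proof -
    have "x\<^sup>2 \<le> (2 * real Q)\<^sup>2" using Q x by (intro power_mono) auto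
    then show ?thesis unfolding x(2) using energy_nonneg by (simp add: field_simps)
  qed
  show "achievable H \<rho> (\<lambda>k. max 0 (real (d k) / real f0 * ln \<rho> - ?c))"
    unfolding achievable_def
  proof (intro conjI allI impI)
    fix \<epsilon> :: real and N :: nat assume "0 < \<epsilon>"
    then obtain T where T: "\<And>n. T \<le> n \<Longrightarrow> (2 / exp 1 :: real) ^ n \<le> \<epsilon>"
      using gauss_tail_eventually_small by blast
    \<comment> \<open>The scheme fixes the number of frequencies, so the block grows in time
      only.\<close>
    define t0 where "t0 = Suc (N + T)"
    define n where "n = f0 * t0"
    have n: "N \<le> n" "T \<le> n" "0 < n"
    proof -
      have "1 * t0 \<le> f0 * t0" using f0 by (intro mult_right_mono) auto
      then show "N \<le> n" "T \<le> n" "0 < n" by (auto simp: n_def t0_def)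
    qed
    \<comment> \<open>Then r/4 is at least \<open>gain * (2 * n)\<close>, the amplified energy of
      typical noise, as \<open>decode_correct\<close> requires.\<close>
    define r where "r = 8 * (gain + 1) * real n"
    have r: "0 \<le> r" using gain_nonneg by (simp add: r_def)
    let ?good = "\<lambda>k C. C \<subseteq> PiE ({..<d k} \<times> {..<t0}) (\<lambda>_. gauss_box Q) \<and>
        (\<forall>x\<in>C. \<forall>y\<in>C. x \<noteq> y \<longrightarrow> r < (\<Sum>p\<in>{..<d k} \<times> {..<t0}. (cmod (y p - x p))\<^sup>2)) \<and>
        real Q ^ (2 * (d k * t0)) \<le> real (card C) * (exp r * 16 ^ (d k * t0))"
    have ex: "\<exists>C. ?good k C" for k
    proof (rule exists_gauss_box_code[of "{..<d k} \<times> {..<t0}" r Q])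
      fix C assume "C \<subseteq> PiE ({..<d k} \<times> {..<t0}) (\<lambda>_. gauss_box Q)"
        and "\<And>x y. x \<in> C \<Longrightarrow> y \<in> C \<Longrightarrow> x \<noteq> y \<Longrightarrow> r < (\<Sum>p\<in>{..<d k} \<times> {..<t0}. (cmod (y p - x p))\<^sup>2)"
        and "real Q ^ (2 * card ({..<d k} \<times> {..<t0})) \<le> real (card C) * (exp r * 16 ^ card ({..<d k} \<times> {..<t0}))"
      then show "\<exists>C. ?good k C"
        unfolding card_cartesian_product card_lessThan by (intro exI[of _ C] conjI ballI impI)
    qed (use r in auto)
    define C where "C k = (SOME C. ?good k C)" for k
    have good: "?good k (C k)" for k
      unfolding C_def by (rule someI_ex[OF ex])
    have C: "C k \<subseteq> PiE ({..<d k} \<times> {..<t0}) (\<lambda>_. gauss_box Q)" for k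
      using good[of k] by (elim conjE)
    have sep: "r < (\<Sum>p\<in>{..<d k} \<times> {..<t0}. (cmod (y p - x p))\<^sup>2)" if "x \<in> C k" "y \<in> C k" "x \<noteq> y" for k x y
      using good[of k] that by blast
    have Csize: "real Q ^ (2 * (d k * t0)) \<le> real (card (C k)) * (exp r * 16 ^ (d k * t0))" for k
      using good[of k] by (elim conjE)
    have finC: "finite (C k)" for k
      using C[of k] by (rule finite_subset) (auto intro!: finite_PiE)
    define M where "M k = card (C k)" for k
    have "\<exists>h. bij_betw h {..<M k} (C k)" for k
      using ex_bij_betw_nat_finite[OF finC] by (simp add: M_def atLeast0LessThan)
    then obtain cw where cw: "\<And>k. bij_betw (cw k) {..<M k} (C k)" by metis
    have M0: "0 < M k" for k
    proof (rule ccontr)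
      assume "\<not> 0 < M k"
      then have "real Q ^ (2 * (d k * t0)) \<le> 0" using Csize[of k] by (simp add: M_def)
      moreover have "0 < real Q ^ (2 * (d k * t0))" using Q(1) by (intro zero_less_power) simp
      ultimately show False by linarith
    qed
    have cwC: "cw k m \<in> C k" if "m < M k" for k m using cw[of k] that by (auto simp: bij_betw_def)
    have code: "is_code H \<rho> f0 t0 M (encode cw) (decode M cw r t0)"
      unfolding is_code_def
    proof (intro conjI allI impI ballI decode_measurable M0 f0)
      show "0 < t0" by (simp add: t0_def)
      fix m assume m: "m \<in> msgs M"
      have "(\<Sum>k<3. \<Sum>p\<in>slots f0 t0. (cmod (encode cw k (m k) p))\<^sup>2) \<le> energy * (real Q)\<^sup>2 * real t0"
      proof (rule encode_power_le)
        fix k q assume "k < (3::nat)" and q: "q \<in> {..<d k} \<times> {..<t0}"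
        then have "cw k (m k) \<in> C k" using m by (intro cwC) (auto simp: msgs_def)
        then show "(cmod (cw k (m k) q))\<^sup>2 \<le> 2 * (real Q)\<^sup>2"
          using C[of k] q by (intro gauss_box_norm_le) blast
      qed
      also have "\<dots> \<le> \<rho> * real t0" using Qpow by (rule mult_right_mono) simp
      also have "\<dots> \<le> \<rho> * real f0 * real t0"
        using \<rho>0 f0 by (intro mult_right_mono) (auto simp: Suc_le_eq)
      finally show "(\<Sum>k<3. \<Sum>p\<in>slots f0 t0. (cmod (encode cw k (m k) p))\<^sup>2) \<le> \<rho> * real f0 * real t0" .
    qed
    have err: "err H f0 t0 M (encode cw) (decode M cw r t0) k \<le> \<epsilon>" if k: "k < 3" for k
    proof -
      have "err H f0 t0 M (encode cw) (decode M cw r t0) k \<le> (2 / exp 1) ^ (f0 * t0)"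
      proof (rule err_le_tail)
        show "decode M cw r t0 k \<in> measurable (PiM (slots f0 t0) (\<lambda>_. borel)) (count_space UNIV)"
          by (rule decode_measurable)
        fix m z assume m: "m \<in> msgs M" and z: "(\<Sum>p\<in>slots f0 t0. (cmod (z p))\<^sup>2) < 2 * real (f0 * t0)"
        have mk: "m k < M k" using m k by (auto simp: msgs_def)
        show "decode M cw r t0 k (rx H f0 t0 (encode cw) m k z) = m k"
        proof (rule decode_correct)
          show "k < 3" "m k < M k" by fact+
        next
          fix m' assume "m' < M k" "m' \<noteq> m k"
          then have "cw k m' \<noteq> cw k (m k)" "cw k m' \<in> C k" "cw k (m k) \<in> C k"
            using cw[of k] mk cwC by (auto simp: bij_betw_def inj_on_def)
          then show "r < (\<Sum>q\<in>{..<d k} \<times> {..<t0}. (cmod (cw k (m k) q - cw k m' q))\<^sup>2)"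
            by (intro sep) auto
        next
          have "gain * (\<Sum>p\<in>slots f0 t0. (cmod (z p))\<^sup>2) \<le> (gain + 1) * (2 * real n)"
            using z gain_nonneg unfolding n_def by (intro mult_mono sum_nonneg) auto
          then show "gain * (\<Sum>p\<in>slots f0 t0. (cmod (z p))\<^sup>2) \<le> r / 4"
            by (simp add: r_def algebra_simps)
        qed
      qed (simp add: M0)
      also have "\<dots> \<le> \<epsilon>" using T[OF n(2)] by (simp add: n_def)
      finally show ?thesis .
    qed
    have rate: "max 0 (real (d k) / real f0 * ln \<rho> - ?c) \<le> ln (real (M k)) / (real f0 * real t0)"
      if k: "k < 3" for k
    proof -
      have "(\<rho> / (4 * (energy + 1))) ^ (d k * t0) \<le> ((real Q)\<^sup>2) ^ (d k * t0)"
        using Qlow \<rho>0 energy_nonneg by (intro power_mono) auto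
      also have "\<dots> \<le> real (M k) * (exp r * 16 ^ (d k * t0))"
        using Csize[of k] by (simp add: power_mult M_def)
      finally have "(\<rho> / (4 * (energy + 1))) ^ (d k * t0) \<le> real (M k) * (exp r * 16 ^ (d k * t0))" .
      then have "ln ((\<rho> / (4 * (energy + 1))) ^ (d k * t0)) \<le> ln (real (M k) * (exp r * 16 ^ (d k * t0)))"
        using \<rho>0 energy_nonneg M0[of k] by (subst ln_le_cancel_iff) auto
      also have "\<dots> = ln (real (M k)) + r + real (d k * t0) * ln 16"
        using M0[of k] by (simp add: ln_mult ln_realpow)
      also have "ln ((\<rho> / (4 * (energy + 1))) ^ (d k * t0)) = real (d k * t0) * (ln \<rho> - ln (4 * (energy + 1)))"
        using \<rho>0 energy_nonneg by (subst ln_realpow) (auto simp: ln_div)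
      finally have "real (d k * t0) * (ln \<rho> - ln (4 * (energy + 1)) - ln 16) - r \<le> ln (real (M k))"
        by (simp add: algebra_simps)
      moreover have "ln (4 * (energy + 1)) + ln 16 = ln (64 * (energy + 1))"
        using energy_nonneg ln_mult[of "4 * (energy + 1)" 16] by simp
      ultimately have l: "real (d k * t0) * (ln \<rho> - ln (64 * (energy + 1))) - r \<le> ln (real (M k))"
        by (simp only: diff_diff_eq)
      have n0: "0 < real f0 * real t0" using f0 by (simp add: t0_def)
      have "real (d k) / real f0 * (ln \<rho> - ln (64 * (energy + 1))) - 8 * (gain + 1)
          = (real (d k * t0) * (ln \<rho> - ln (64 * (energy + 1))) - r) / (real f0 * real t0)"
      proof -
        have "a / F * L - g = (a * T * L - g * (F * T)) / (F * T)" if "0 < F * T" for a F T L g :: real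
          using that by (auto simp: diff_divide_distrib)
        from this[OF n0] show ?thesis by (simp add: r_def n_def)
      qed
      also have "\<dots> \<le> ln (real (M k)) / (real f0 * real t0)"
        using l n0 by (intro divide_right_mono) auto
      finally have "real (d k) / real f0 * ln \<rho> - real (d k) / real f0 * ln (64 * (energy + 1)) - 8 * (gain + 1)
          \<le> ln (real (M k)) / (real f0 * real t0)" by (simp add: right_diff_distrib)
      moreover have "real (d k) / real f0 * ln (64 * (energy + 1)) \<le> real num_streams * ln (64 * (energy + 1))"
      proof (rule mult_right_mono)
        have "real (d k) / real f0 \<le> real (d k)" using f0 by (simp add: divide_le_eq mult_le_cancel_left1)
        then show "real (d k) / real f0 \<le> real num_streams" using d_le_num_streams[OF k] by (meson of_nat_le_iff order_trans)
        show "0 \<le> ln (64 * (energy + 1))" using energy_nonneg by simp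
      qed
      moreover have "0 \<le> ln (real (M k)) / (real f0 * real t0)"
        using M0[of k] by simp
      ultimately show ?thesis by linarith
    qed
    show "\<exists>f0' t0' M enc dec. N \<le> f0' * t0' \<and> is_code H \<rho> f0' t0' M enc dec \<and>
        (\<forall>k<3. max 0 (real (d k) / real f0 * ln \<rho> - ?c) \<le> ln (real (M k)) / (real f0' * real t0') \<and>
           err H f0' t0' M enc dec k \<le> \<epsilon>)"
      by (intro exI[of _ f0] exI[of _ t0] exI[of _ M] exI[of _ "encode cw"] exI[of _ "decode M cw r t0"]
        conjI allI impI code err rate) (use n(1) in \<open>simp add: n_def\<close>)
  qed simp
qed

end

section \<open>Generic nonsingularity of the alignment matrices\<close>

text \<open>Replacing one coordinate of a product sample by an independent fresh draw does not
  change its law. By Fubini, a property may therefore be checked with all other coordinates frozen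
  and this one random.\<close>

lemma (in prob_space) AE_PiM_resample:
  fixes i :: 'i
  assumes P: "Measurable.pred (PiM UNIV (\<lambda>_::'i. M)) P"
    and AE: "AE \<omega> in PiM UNIV (\<lambda>_::'i. M). AE h in M. P (fun_upd \<omega> i h)"
  shows "AE \<omega> in PiM UNIV (\<lambda>_::'i. M). P \<omega>"
proof -
  let ?P = "PiM UNIV (\<lambda>_::'i. M)"
  interpret P: prob_space ?P by (intro prob_space_PiM prob_space_axioms)
  interpret MP: pair_sigma_finite M ?P ..
  have [measurable]: "(\<lambda>(x, \<omega>). fun_upd \<omega> i x) \<in> measurable (M \<Otimes>\<^sub>M ?P) ?P"
  proof (rule measurable_PiM_single')
    show "(\<lambda>x. (case x of (h, \<omega>) \<Rightarrow> fun_upd \<omega> i h) j) \<in> measurable (M \<Otimes>\<^sub>M ?P) M" for j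
      by (cases "j = i") (simp_all add: case_prod_beta)
  qed (auto simp: space_pair_measure space_PiM)
  have eq: "distr (M \<Otimes>\<^sub>M ?P) ?P (\<lambda>(x, \<omega>). fun_upd \<omega> i x) = ?P"
    using distr_pair_PiM_eq_PiM[of UNIV "\<lambda>_. M" i] prob_space_axioms by simp
  have m: "Measurable.pred (M \<Otimes>\<^sub>M ?P) (\<lambda>x. P (fun_upd (snd x) i (fst x)))"
    using measurable_compose[OF \<open>(\<lambda>(x, \<omega>). fun_upd \<omega> i x) \<in> measurable (M \<Otimes>\<^sub>M ?P) ?P\<close> P]
    by (simp add: case_prod_beta)
  have "AE h in M. AE \<omega> in ?P. P (fun_upd \<omega> i h)"
    using AE MP.AE_commute[of "\<lambda>h \<omega>. P (fun_upd \<omega> i h)"] m by (simp add: pred_def)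
  then have "AE x in M \<Otimes>\<^sub>M ?P. P (fun_upd (snd x) i (fst x))"
    using m by (intro MP.AE_pair_measure) (auto simp: pred_def)
  then have "AE \<omega> in distr (M \<Otimes>\<^sub>M ?P) ?P (\<lambda>(x, \<omega>). fun_upd \<omega> i x). P \<omega>"
    by (subst AE_distr_iff) (use P in \<open>auto simp: case_prod_beta pred_def\<close>)
  then show ?thesis unfolding eq .
qed

lemma borel_measurable_det:
  assumes "\<And>f j. f < n \<Longrightarrow> j < n \<Longrightarrow> (\<lambda>\<omega>. A \<omega> f j :: complex) \<in> borel_measurable M"
  shows "(\<lambda>\<omega>. Determinant.det (Matrix.mat n n (\<lambda>(f, j). A \<omega> f j))) \<in> borel_measurable M"
proof -
  have "Determinant.det (Matrix.mat n n (\<lambda>(f, j). A \<omega> f j))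
     = (\<Sum>p\<in>{p. p permutes {0..<n}}. signof p * (\<Prod>i = 0..<n. A \<omega> i (p i)))" for \<omega>
  proof -
    have "(\<Prod>i = 0..<n. Matrix.mat n n (\<lambda>(f, j). A \<omega> f j) $$ (i, p i)) = (\<Prod>i = 0..<n. A \<omega> i (p i))"
      if "p permutes {0..<n}" for p
      using that by (intro prod.cong refl) (auto simp: permutes_in_image)
    then show ?thesis by (auto simp: Determinant.det_def intro!: sum.cong)
  qed
  moreover have "(\<lambda>\<omega>. \<Sum>p\<in>{p. p permutes {0..<n}}. signof p * (\<Prod>i = 0..<n. A \<omega> i (p i))) \<in> borel_measurable M"
    by (intro borel_measurable_sum borel_measurable_times borel_measurable_const borel_measurable_prod assms)
      (auto simp: permutes_in_image dest: permutes_in_image[THEN iffD2])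
  ultimately show ?thesis by simp
qed

text \<open>Laplace expansion arranged for induction on the number of slots: the cofactors depend
  only on the earlier rows, hence not on the coefficients of the new slot, and the last cofactor is
  the determinant of the previous stage.\<close>

lemma det_last_row_expansion:
  obtains c :: "'w \<Rightarrow> nat \<Rightarrow> complex" where
    "\<And>\<omega>. Determinant.det (Matrix.mat (Suc m) (Suc m) (\<lambda>(f, j). A \<omega> f j)) = (\<Sum>j<Suc m. c \<omega> j * A \<omega> m j)"
    "\<And>\<omega>. c \<omega> m = Determinant.det (Matrix.mat m m (\<lambda>(f, j). A \<omega> f j))"
    "\<And>\<omega> \<omega>' j. (\<And>f j. f < m \<Longrightarrow> A \<omega> f j = A \<omega>' f j) \<Longrightarrow> c \<omega> j = c \<omega>' j"
    "\<And>M j. (\<And>f j. (\<lambda>\<omega>. A \<omega> f j) \<in> borel_measurable M) \<Longrightarrow> (\<lambda>\<omega>. c \<omega> j) \<in> borel_measurable M"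
proof
  define c where "c \<omega> j = (- 1) ^ (m + j) *
     Determinant.det (Matrix.mat m m (\<lambda>(f, j'). A \<omega> f (if j' < j then j' else Suc j')))" for \<omega> j
  let ?B = "\<lambda>\<omega>. Matrix.mat (Suc m) (Suc m) (\<lambda>(f, j). A \<omega> f j)"
  have del: "mat_delete (?B \<omega>) m j = Matrix.mat m m (\<lambda>(f, j'). A \<omega> f (if j' < j then j' else Suc j'))" for \<omega> j
    by (rule eq_matI) (auto simp: mat_delete_def)
  show "Determinant.det (?B \<omega>) = (\<Sum>j<Suc m. c \<omega> j * A \<omega> m j)" for \<omega>
    by (subst laplace_expansion_row[of _ "Suc m" m])
      (auto simp: cofactor_def del c_def mult_ac intro!: sum.cong)
  show "c \<omega> m = Determinant.det (Matrix.mat m m (\<lambda>(f, j). A \<omega> f j))" for \<omega>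
  proof -
    have "Matrix.mat m m (\<lambda>(f, j'). A \<omega> f (if j' < m then j' else Suc j')) = Matrix.mat m m (\<lambda>(f, j). A \<omega> f j)"
      by (rule eq_matI) auto
    then show ?thesis by (simp add: c_def)
  qed
  show "c \<omega> j = c \<omega>' j" if "\<And>f j. f < m \<Longrightarrow> A \<omega> f j = A \<omega>' f j" for \<omega> \<omega>' j
  proof -
    have "Matrix.mat m m (\<lambda>(f, j'). A \<omega> f (if j' < j then j' else Suc j'))
       = Matrix.mat m m (\<lambda>(f, j'). A \<omega>' f (if j' < j then j' else Suc j'))"
      by (rule eq_matI) (auto simp: that)
    then show ?thesis by (simp add: c_def)
  qed
  show "(\<lambda>\<omega>. c \<omega> j) \<in> borel_measurable M" if "\<And>f j. (\<lambda>\<omega>. A \<omega> f j) \<in> borel_measurable M" for M j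
    unfolding c_def using that
    by (intro borel_measurable_times borel_measurable_const borel_measurable_det)
qed

lemma det_nonzero_left_inverse:
  assumes "Determinant.det (Matrix.mat n n (\<lambda>(f, j). A f j :: complex)) \<noteq> 0"
  obtains B where "\<And>i j. i < n \<Longrightarrow> j < n \<Longrightarrow> (\<Sum>f<n. B i f * A f j) = (if i = j then 1 else 0)"
proof -
  let ?A = "Matrix.mat n n (\<lambda>(f, j). A f j)"
  have car: "?A \<in> carrier_mat n n" by simp
  from det_non_zero_imp_unit[OF car assms] obtain B where B: "B \<in> carrier_mat n n" "B * ?A = 1\<^sub>m n"
    by (auto simp: Units_def ring_mat_def)
  have "(\<Sum>f<n. B $$ (i, f) * A f j) = (if i = j then 1 else 0)" if "i < n" "j < n" for i j
  proof -
    have "(B * ?A) $$ (i, j) = (\<Sum>f<n. B $$ (i, f) * A f j)"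
      using that B(1) by (simp add: scalar_prod_def atLeast0LessThan)
    then show ?thesis using that unfolding B(2) by simp
  qed
  then show thesis by (rule that)
qed

section \<open>Random channels and the received alignment matrices\<close>

locale channel_law = prob_space \<mu> for \<mu> :: "complex measure" +
  fixes hmin hmax :: real
  assumes sets_\<mu>[measurable_cong, simp]: "sets \<mu> = sets borel"
    and ac: "absolutely_continuous lborel \<mu>"
    and hmin: "0 < hmin"
    and bounds: "AE h in \<mu>. hmin \<le> cmod h \<and> cmod h \<le> hmax"
begin

abbreviation chan :: "(nat \<times> nat \<times> nat \<Rightarrow> complex) measure" where
  "chan \<equiv> PiM UNIV (\<lambda>_. \<mu>)"

lemma space_chan[simp]: "space chan = UNIV"
  using sets_eq_imp_space_eq[OF sets_\<mu>] by (simp add: space_PiM)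

lemma measurable_coordinate[measurable]: "(\<lambda>\<omega>. \<omega> i) \<in> borel_measurable chan"
proof -
  have "(\<lambda>\<omega>. \<omega> i) \<in> measurable chan \<mu>" by (rule measurable_component_singleton) simp
  then show ?thesis by (simp cong: measurable_cong_sets)
qed

text \<open>This is how the continuity of the channel law enters: with the other coefficients
  frozen, the exceptional values of one coefficient are finitely many.\<close>

lemma AE_notin_finite:
  assumes "finite F"
  shows "AE h in \<mu>. h \<notin> F"
proof -
  have "F \<in> null_sets lborel" using assms by (rule finite_imp_null_set_lborel)
  then have "F \<in> null_sets \<mu>" using ac by (auto simp: absolutely_continuous_def)
  then show ?thesis by (rule AE_not_in)
qed

lemma AE_chan_bounds: "AE \<omega> in chan. \<forall>i. hmin \<le> cmod (\<omega> i) \<and> cmod (\<omega> i) \<le> hmax"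
  unfolding AE_all_countable
  by (rule allI, rule AE_PiM_component[where P = "\<lambda>h. hmin \<le> cmod h \<and> cmod h \<le> hmax"])
    (rule prob_space_axioms UNIV_I bounds)+

lemma AE_chan_nonzero: "AE \<omega> in chan. \<forall>i. \<omega> i \<noteq> 0"
  using AE_chan_bounds
proof eventually_elim
  case (elim \<omega>)
  show ?case
  proof
    fix i
    have "0 < cmod (\<omega> i)" using elim hmin by (meson less_le_trans)
    then show "\<omega> i \<noteq> 0" by simp
  qed
qed

text \<open>In the notation of Cadambe and Jafar (users numbered from 1), \<open>loop_gain\<close> is the diagonal of
  \<open>T = H32 H13 H21 / (H12 H23 H31)\<close>, and the \<open>i\<close>-th beam of user \<open>k\<close> is \<open>beam k * T ^ i\<close>. All interference
  at receiver \<open>k\<close> then lies in the span of the vectors \<open>interf k * T ^ i\<close>; the columns of \<open>rx_entry\<close> are the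
  \<open>d\<close> desired directions followed by these. None of \<open>beam\<close>, \<open>interf\<close>, \<open>loop_gain\<close> involves a direct
  channel \<open>H_kk\<close>.\<close>

definition tau :: "(nat \<times> nat \<times> nat \<Rightarrow> complex) \<Rightarrow> nat \<Rightarrow> complex" where
  "tau \<omega> f = \<omega> (2, 1, f) * \<omega> (1, 0, f) / (\<omega> (0, 1, f) * \<omega> (1, 2, f) * \<omega> (2, 0, f))"

definition loop_gain :: "(nat \<times> nat \<times> nat \<Rightarrow> complex) \<Rightarrow> nat \<Rightarrow> complex" where
  "loop_gain \<omega> f = \<omega> (0, 2, f) * tau \<omega> f"

definition beam :: "nat \<Rightarrow> (nat \<times> nat \<times> nat \<Rightarrow> complex) \<Rightarrow> nat \<Rightarrow> complex" where
  "beam k \<omega> f = (if k = 0 then 1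
     else if k = 1 then \<omega> (0, 2, f) * \<omega> (1, 0, f) / (\<omega> (0, 1, f) * \<omega> (1, 2, f))
     else \<omega> (1, 0, f) / \<omega> (1, 2, f))"

definition interf :: "nat \<Rightarrow> (nat \<times> nat \<times> nat \<Rightarrow> complex) \<Rightarrow> nat \<Rightarrow> complex" where
  "interf k \<omega> f = (if k = 0 then \<omega> (0, 2, f) * \<omega> (1, 0, f) / \<omega> (1, 2, f)
     else if k = 1 then \<omega> (1, 0, f) else \<omega> (2, 0, f))"

definition rx_entry :: "nat \<Rightarrow> nat \<Rightarrow> (nat \<times> nat \<times> nat \<Rightarrow> complex) \<Rightarrow> nat \<Rightarrow> nat \<Rightarrow> complex" where
  "rx_entry k d \<omega> f j = (if j < d then \<omega> (k, k, f) * beam k \<omega> f * loop_gain \<omega> f ^ j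
     else interf k \<omega> f * loop_gain \<omega> f ^ (j - d))"

lemma slot_measurable[measurable]:
  "(\<lambda>\<omega>. loop_gain \<omega> f) \<in> borel_measurable chan"
  "(\<lambda>\<omega>. beam k \<omega> f) \<in> borel_measurable chan"
  "(\<lambda>\<omega>. interf k \<omega> f) \<in> borel_measurable chan"
  "(\<lambda>\<omega>. rx_entry k d \<omega> f j) \<in> borel_measurable chan"
proof -
  show [measurable]: "(\<lambda>\<omega>. loop_gain \<omega> f) \<in> borel_measurable chan"
    "(\<lambda>\<omega>. beam k \<omega> f) \<in> borel_measurable chan"
    "(\<lambda>\<omega>. interf k \<omega> f) \<in> borel_measurable chan" for f k
    unfolding loop_gain_def tau_def beam_def interf_def by measurable
  show "(\<lambda>\<omega>. rx_entry k d \<omega> f j) \<in> borel_measurable chan"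
    unfolding rx_entry_def by measurable
qed

text \<open>\<open>loop_gain\<close> is linear in the cross coefficient
  \<open>\<omega> (0, 2, m)\<close> with nonzero slope \<open>tau\<close>, and the coefficients of
  the polynomial ignore slot \<open>m\<close>. A fresh draw of this coefficient therefore misses the
  finitely many roots almost surely.\<close>

lemma AE_polynomial_nonzero:
  assumes c: "\<And>j. (\<lambda>\<omega>. c \<omega> j) \<in> borel_measurable chan"
    and inv: "\<And>\<omega> h j. c (fun_upd \<omega> (0, 2, m) h) j = c \<omega> j"
    and top: "AE \<omega> in chan. c \<omega> e \<noteq> 0"
  shows "AE \<omega> in chan. (\<Sum>j\<le>e. c \<omega> j * loop_gain \<omega> m ^ j) \<noteq> 0"
proof (rule AE_PiM_resample[where i = "(0, 2, m)"])
  note [measurable] = c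
  show "Measurable.pred chan (\<lambda>\<omega>. (\<Sum>j\<le>e. c \<omega> j * loop_gain \<omega> m ^ j) \<noteq> 0)" by measurable
  show "AE \<omega> in chan. AE h in \<mu>.
      (\<Sum>j\<le>e. c (fun_upd \<omega> (0, 2, m) h) j * loop_gain (fun_upd \<omega> (0, 2, m) h) m ^ j) \<noteq> 0"
    using top AE_chan_nonzero
  proof eventually_elim
    case (elim \<omega>)
    have t: "tau \<omega> m \<noteq> 0" using elim by (simp add: tau_def)
    have lg: "loop_gain (fun_upd \<omega> (0, 2, m) h) m = h * tau \<omega> m" for h
      by (simp add: loop_gain_def tau_def)
    have "finite {x. (\<Sum>j\<le>e. c \<omega> j * x ^ j) = 0}"
      using elim by (subst polyfun_finite_roots) auto
    then have "finite ((\<lambda>h. h * tau \<omega> m) -` {x. (\<Sum>j\<le>e. c \<omega> j * x ^ j) = 0})"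
      using t by (intro finite_vimageI) (auto simp: inj_on_def)
    from AE_notin_finite[OF this] show ?case
      by eventually_elim (simp add: lg inv)
  qed
qed

text \<open>Given the earlier slots, resampling \<open>\<omega> (0, 2, m)\<close> moves the loop gain away from the finitely many
  roots of a nonzero polynomial; after that the sum is a nonzero affine function of \<open>\<omega> (k, k, m)\<close>, on
  which nothing else depends.\<close>

lemma AE_last_row_nonzero:
  assumes k: "k < 3"
    and c: "\<And>j. (\<lambda>\<omega>. c \<omega> j) \<in> borel_measurable chan"
    and inv: "\<And>\<omega> h a b j. c (fun_upd \<omega> (a, b, m) h) j = c \<omega> j"
    and top: "AE \<omega> in chan. c \<omega> m \<noteq> 0"
  shows "AE \<omega> in chan. (\<Sum>j<Suc m. c \<omega> j * rx_entry k d \<omega> m j) \<noteq> 0"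
proof -
  note [measurable] = c
  define P where "P \<omega> = (\<Sum>j\<in>{j. j < Suc m \<and> j < d}. c \<omega> j * loop_gain \<omega> m ^ j)" for \<omega>
  define Q where "Q \<omega> = (\<Sum>j\<in>{j. j < Suc m \<and> \<not> j < d}. c \<omega> j * loop_gain \<omega> m ^ (j - d))" for \<omega>
  have split: "(\<Sum>j<Suc m. c \<omega> j * rx_entry k d \<omega> m j)
      = \<omega> (k, k, m) * (beam k \<omega> m * P \<omega>) + interf k \<omega> m * Q \<omega>" for \<omega>
  proof -
    have "(\<Sum>j<Suc m. c \<omega> j * rx_entry k d \<omega> m j)
      = (\<Sum>j<Suc m. if j < d then \<omega> (k, k, m) * beam k \<omega> m * (c \<omega> j * loop_gain \<omega> m ^ j)
          else interf k \<omega> m * (c \<omega> j * loop_gain \<omega> m ^ (j - d)))"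
      by (intro sum.cong) (auto simp: rx_entry_def)
    also have "\<dots> = (\<Sum>j\<in>{j. j < Suc m \<and> j < d}. \<omega> (k, k, m) * beam k \<omega> m * (c \<omega> j * loop_gain \<omega> m ^ j))
       + (\<Sum>j\<in>{j. j < Suc m \<and> \<not> j < d}. interf k \<omega> m * (c \<omega> j * loop_gain \<omega> m ^ (j - d)))"
      by (subst sum.If_cases) (auto simp: Int_def Compl_eq)
    finally show ?thesis by (simp add: P_def Q_def sum_distrib_left mult.assoc)
  qed
  \<comment> \<open>The coefficient \<open>c \<omega> m\<close>, nonzero by assumption, is the
    leading one of \<open>P\<close> if column \<open>m\<close> is a desired direction, and of
    \<open>Q\<close>, then of degree \<open>m - d\<close>, if it is an interference
    direction.\<close>
  have gen: "AE \<omega> in chan. if m < d then P \<omega> \<noteq> 0 else Q \<omega> \<noteq> 0"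
  proof (cases "m < d")
    case True
    then have "{j. j < Suc m \<and> j < d} = {..m}" by auto
    then show ?thesis
      using AE_polynomial_nonzero[of c m m] c inv top True by (simp add: P_def)
  next
    case False
    have "Q \<omega> = (\<Sum>j\<le>m - d. c \<omega> (j + d) * loop_gain \<omega> m ^ j)" for \<omega>
      unfolding Q_def
      by (rule sum.reindex_bij_witness[of _ "\<lambda>j. j + d" "\<lambda>j. j - d"]) (use False in auto)
    then show ?thesis
      using AE_polynomial_nonzero[of "\<lambda>\<omega> j. c \<omega> (j + d)" m "m - d"] c inv top False by simp
  qed
  show ?thesis
    unfolding split
  proof (rule AE_PiM_resample[where i = "(k, k, m)"])
    show "Measurable.pred chan (\<lambda>\<omega>. \<omega> (k, k, m) * (beam k \<omega> m * P \<omega>) + interf k \<omega> m * Q \<omega> \<noteq> 0)"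
      unfolding P_def Q_def by measurable
    show "AE \<omega> in chan. AE h in \<mu>. fun_upd \<omega> (k, k, m) h (k, k, m)
        * (beam k (fun_upd \<omega> (k, k, m) h) m * P (fun_upd \<omega> (k, k, m) h))
        + interf k (fun_upd \<omega> (k, k, m) h) m * Q (fun_upd \<omega> (k, k, m) h) \<noteq> 0"
      using gen AE_chan_nonzero
    proof eventually_elim
      case (elim \<omega>)
      have lg: "loop_gain (fun_upd \<omega> (k, k, m) h) m = loop_gain \<omega> m" for h
        by (auto simp: loop_gain_def tau_def)
      have PQ: "P (fun_upd \<omega> (k, k, m) h) = P \<omega>" "Q (fun_upd \<omega> (k, k, m) h) = Q \<omega>" for h
        by (simp_all add: P_def Q_def lg inv)
      have bi: "beam k (fun_upd \<omega> (k, k, m) h) m = beam k \<omega> m"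
        "interf k (fun_upd \<omega> (k, k, m) h) m = interf k \<omega> m" for h
        using k by (auto simp: beam_def interf_def)
      have nz: "beam k \<omega> m \<noteq> 0" "interf k \<omega> m \<noteq> 0"
        using elim by (auto simp: beam_def interf_def)
      have Q0: "Q \<omega> = 0" if "m < d" using that by (simp add: Q_def) (metis (no_types, lifting) empty_Collect_eq less_Suc_eq less_trans sum.empty)
      \<comment> \<open>As a function of the direct coefficient \<open>h\<close> the sum is affine
        with slope a nonzero multiple of \<open>P\<close> and constant term a nonzero multiple of
        \<open>Q\<close>: at most one root if \<open>P\<close> is nonzero, and none if only
        \<open>Q\<close> is.\<close>
      have "finite {h. h * (beam k \<omega> m * P \<omega>) + interf k \<omega> m * Q \<omega> = 0}"
      proof (cases "P \<omega> = 0")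
        case True
        then have "Q \<omega> \<noteq> 0" using elim by (auto split: if_splits)
        then show ?thesis using True nz by simp
      next
        case False
        have "{h. h * (beam k \<omega> m * P \<omega>) + interf k \<omega> m * Q \<omega> = 0}
            \<subseteq> {- (interf k \<omega> m * Q \<omega>) / (beam k \<omega> m * P \<omega>)}"
          using False nz by (auto simp: field_simps eq_neg_iff_add_eq_0)
        then show ?thesis by (rule finite_subset) simp
      qed
      from AE_notin_finite[OF this] show ?case
        by eventually_elim (simp add: PQ bi)
    qed
  qed
qed

text \<open>The number \<open>d\<close> of desired columns stays fixed while the size grows, so the
  induction runs through all leading square blocks, including those too small to contain an
  interference column.\<close>

lemma AE_rx_matrix_nonsingular:
  assumes k: "k < 3"
  shows "AE \<omega> in chan. Determinant.det (Matrix.mat N N (\<lambda>(f, j). rx_entry k d \<omega> f j)) \<noteq> 0"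
proof (induction N)
  case 0
  show ?case by simp
next
  case (Suc m)
  obtain c :: "(nat \<times> nat \<times> nat \<Rightarrow> complex) \<Rightarrow> nat \<Rightarrow> complex" where
    c: "\<And>\<omega>. Determinant.det (Matrix.mat (Suc m) (Suc m) (\<lambda>(f, j). rx_entry k d \<omega> f j))
        = (\<Sum>j<Suc m. c \<omega> j * rx_entry k d \<omega> m j)"
      "\<And>\<omega>. c \<omega> m = Determinant.det (Matrix.mat m m (\<lambda>(f, j). rx_entry k d \<omega> f j))"
      "\<And>\<omega> \<omega>' j. (\<And>f j. f < m \<Longrightarrow> rx_entry k d \<omega> f j = rx_entry k d \<omega>' f j) \<Longrightarrow> c \<omega> j = c \<omega>' j"
      "\<And>M j. (\<And>f j. (\<lambda>\<omega>. rx_entry k d \<omega> f j) \<in> borel_measurable M) \<Longrightarrow> (\<lambda>\<omega>. c \<omega> j) \<in> borel_measurable M"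
    by (rule det_last_row_expansion[of m "rx_entry k d"]) blast
  show ?case
    unfolding c(1)
  proof (rule AE_last_row_nonzero[OF k])
    show "(\<lambda>\<omega>. c \<omega> j) \<in> borel_measurable chan" for j by (rule c(4)) measurable
    show "c (fun_upd \<omega> (a, b, m) h) j = c \<omega> j" for \<omega> h a b j
      by (rule c(3)) (simp add: rx_entry_def loop_gain_def tau_def beam_def interf_def)
    show "AE \<omega> in chan. c \<omega> m \<noteq> 0" unfolding c(2) by (rule Suc.IH)
  qed
qed

end

section \<open>The degrees of freedom region\<close>

context channel_law
begin

text \<open>The receive filters of user \<open>k\<close> are rows of a left inverse of its received
  matrix: row \<open>i\<close> returns desired stream \<open>i\<close> and vanishes on the other
  desired columns and on all interference columns.\<close>

lemma alignment_scheme: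
  assumes nz: "\<forall>i. \<omega> i \<noteq> 0"
    and det: "\<And>k. k < 3 \<Longrightarrow> Determinant.det (Matrix.mat (2 * n + 1) (2 * n + 1)
      (\<lambda>(f, j). rx_entry k (if k = 0 then n + 1 else n) \<omega> f j)) \<noteq> 0"
  obtains U where "linear_scheme \<omega> (2 * n + 1) (\<lambda>k. if k = 0 then n + 1 else n)
     (\<lambda>k f i. beam k \<omega> f * loop_gain \<omega> f ^ i) U"
proof -
  let ?d = "\<lambda>k::nat. if k = 0 then n + 1 else n"
  let ?good = "\<lambda>k B. \<forall>i j. i < 2 * n + 1 \<longrightarrow> j < 2 * n + 1 \<longrightarrow>
      (\<Sum>f<2 * n + 1. B i f * rx_entry k (?d k) \<omega> f j) = (if i = j then 1 else 0)"
  define U where "U k = (SOME B. ?good k B)" for k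
  have "\<exists>B. ?good k B" if "k < 3" for k
    using det_nonzero_left_inverse[OF det[OF that]] by metis
  then have U: "(\<Sum>f<2 * n + 1. U k i f * rx_entry k (?d k) \<omega> f j) = (if i = j then 1 else 0)"
    if "k < 3" "i < 2 * n + 1" "j < 2 * n + 1" for k i j
    using someI_ex[of "?good k"] that unfolding U_def by blast
  \<comment> \<open>Every beam arrives as a column of the received matrix. Equal powers align at
    receivers 0 and 1; at receiver 2 the beams of user 1 carry one extra factor
    \<open>loop_gain\<close>. Their powers 1 to n lie among the powers 0 to n sent by user 0, which
    is why that user has n + 1 streams.\<close>
  have entry: "\<omega> (k, j, f) * (beam j \<omega> f * loop_gain \<omega> f ^ i)
      = rx_entry k (?d k) \<omega> f (if k = j then i else ?d k + (if k = 2 \<and> j = 1 then Suc i else i))"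
    if "k < 3" "j < 3" "i < ?d j" for k j f i
  proof -
    have "k = 0 \<or> k = 1 \<or> k = 2" "j = 0 \<or> j = 1 \<or> j = 2" using that by linarith+
    then show ?thesis
      using nz that(3)
      by (elim disjE) (simp_all add: rx_entry_def beam_def interf_def loop_gain_def tau_def field_simps)
  qed
  have "linear_scheme \<omega> (2 * n + 1) ?d (\<lambda>k f i. beam k \<omega> f * loop_gain \<omega> f ^ i) U"
  proof
    fix k j i i' assume kj: "k < 3" "j < 3" and i: "i < ?d k" "i' < ?d j"
    let ?e = "if k = j then i' else ?d k + (if k = 2 \<and> j = 1 then Suc i' else i')"
    have "?e < 2 * n + 1" "i < 2 * n + 1" "i = ?e \<longleftrightarrow> k = j \<and> i = i'"
      using i by (auto split: if_splits)
    then show "(\<Sum>f<2 * n + 1. U k i f * (\<omega> (k, j, f) * (beam j \<omega> f * loop_gain \<omega> f ^ i')))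
        = (if k = j \<and> i = i' then 1 else 0)"
      using U[OF kj(1), of i ?e] unfolding entry[OF kj i(2)] by simp
  qed simp
  then show thesis by (rule that)
qed

end

section \<open>Weighted sums and the vertices of the region\<close>

lemma single_user_scheme:
  assumes "H (u, u, 0) \<noteq> 0"
  shows "linear_scheme H 1 (\<lambda>k. if k = u then 1 else 0) (\<lambda>_ _ _. 1) (\<lambda>_ _ _. 1 / H (u, u, 0))"
  using assms by unfold_locales (auto split: if_splits)

abbreviation weighted_dof :: "(nat \<times> nat \<times> nat \<Rightarrow> complex) \<Rightarrow> real \<Rightarrow> real \<Rightarrow> real \<Rightarrow> ereal" where
  "weighted_dof H w1 w2 w3 \<equiv> Limsup at_top (\<lambda>\<rho>::real.
     (SUP R\<in>cap_region H \<rho>. ereal (w1 * R 0 + w2 * R 1 + w3 * R 2)) / ereal (ln \<rho>))"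

text \<open>The rate offset \<open>c\<close> of the scheme stays fixed as \<rho> grows, so it
  contributes only \<open>b / ln \<rho>\<close>, which tends to 0; the ratio of streams to
  frequencies remains.\<close>

lemma (in linear_scheme) weighted_dof_ge:
  fixes w1 w2 w3 :: real
  assumes w: "0 \<le> w1" "0 \<le> w2" "0 \<le> w3"
  shows "ereal ((w1 * d 0 + w2 * d 1 + w3 * d 2) / f0) \<le> weighted_dof H w1 w2 w3"
proof -
  obtain c where c: "\<And>\<rho>. energy + 1 \<le> \<rho> \<Longrightarrow> achievable H \<rho> (\<lambda>k. max 0 (real (d k) / real f0 * ln \<rho> - c))"
    using linear_scheme_rates by blast
  define a where "a = (w1 * d 0 + w2 * d 1 + w3 * d 2) / f0"
  define b where "b = (w1 + w2 + w3) * c"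
  let ?F = "\<lambda>\<rho>. (SUP R\<in>cap_region H \<rho>. ereal (w1 * R 0 + w2 * R 1 + w3 * R 2)) / ereal (ln \<rho>)"
  have ev: "eventually (\<lambda>\<rho>. ereal (a - b / ln \<rho>) \<le> ?F \<rho>) at_top"
    using eventually_ge_at_top[of "energy + 1"] eventually_gt_at_top[of 1]
  proof eventually_elim
    case (elim \<rho>)
    let ?R = "\<lambda>k. max 0 (real (d k) / real f0 * ln \<rho> - c)"
    have l: "0 < ln \<rho>" using elim by simp
    have R: "?R \<in> cap_region H \<rho>" using c[OF elim(1)] by (simp add: cap_region_def)
    have "(a - b / ln \<rho>) * ln \<rho> = w1 * (real (d 0) / real f0 * ln \<rho> - c)
        + w2 * (real (d 1) / real f0 * ln \<rho> - c) + w3 * (real (d 2) / real f0 * ln \<rho> - c)"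
      using l f0 by (simp add: a_def b_def field_simps)
    also have "\<dots> \<le> w1 * ?R 0 + w2 * ?R 1 + w3 * ?R 2"
      using w by (intro add_mono mult_left_mono) auto
    finally have "ereal ((a - b / ln \<rho>) * ln \<rho>) \<le> ereal (w1 * ?R 0 + w2 * ?R 1 + w3 * ?R 2)" by simp
    also have "\<dots> \<le> (SUP R\<in>cap_region H \<rho>. ereal (w1 * R 0 + w2 * R 1 + w3 * R 2))"
      by (rule SUP_upper2[OF R]) simp
    finally have "ereal ((a - b / ln \<rho>) * ln \<rho>) / ereal (ln \<rho>) \<le> ?F \<rho>"
      using l by (intro ereal_divide_right_mono) auto
    then show ?case using l by simp
  qed
  have "((\<lambda>\<rho>. a - b / ln \<rho>) \<longlongrightarrow> a) at_top" by real_asymp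
  then have "((\<lambda>\<rho>. ereal (a - b / ln \<rho>)) \<longlongrightarrow> ereal a) at_top" by simp
  then have "ereal a = Limsup at_top (\<lambda>\<rho>. ereal (a - b / ln \<rho>))"
    by (intro lim_imp_Limsup[symmetric]) auto
  also have "\<dots> \<le> Limsup at_top ?F" by (rule Limsup_mono[OF ev])
  finally show ?thesis unfolding a_def .
qed

lemma weighted_dof_le_one:
  fixes w1 w2 w3 c :: real
  assumes bound: "\<And>\<rho> R. 1 \<le> \<rho> \<Longrightarrow> achievable H \<rho> R \<Longrightarrow> w1 * R 0 + w2 * R 1 + w3 * R 2 \<le> ln \<rho> + c"
  shows "weighted_dof H w1 w2 w3 \<le> 1"
proof -
  let ?F = "\<lambda>\<rho>. (SUP R\<in>cap_region H \<rho>. ereal (w1 * R 0 + w2 * R 1 + w3 * R 2)) / ereal (ln \<rho>)"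
  have ev: "eventually (\<lambda>\<rho>. ?F \<rho> \<le> ereal (1 + c / ln \<rho>)) at_top"
    using eventually_gt_at_top[of 1]
  proof eventually_elim
    case (elim \<rho>)
    have l: "0 < ln \<rho>" using elim by simp
    have "?F \<rho> \<le> ereal (ln \<rho> + c) / ereal (ln \<rho>)"
      using l bound elim by (intro ereal_divide_right_mono SUP_least) (auto simp: cap_region_def)
    then show ?case using l by (simp add: add_divide_distrib)
  qed
  have "((\<lambda>\<rho>. 1 + c / ln \<rho>) \<longlongrightarrow> 1) at_top" by real_asymp
  then have lim: "((\<lambda>\<rho>. ereal (1 + c / ln \<rho>)) \<longlongrightarrow> ereal 1) at_top" by simp
  have "Limsup at_top ?F \<le> Limsup at_top (\<lambda>\<rho>. ereal (1 + c / ln \<rho>))" by (rule Limsup_mono[OF ev])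
  also have "\<dots> = ereal 1" using lim by (intro lim_imp_Limsup) auto
  finally show ?thesis by (simp add: one_ereal_def)
qed

lemma weighted_sum_le_vertex_max:
  fixes d1 d2 d3 w1 w2 w3 :: real
  assumes d: "0 \<le> d1" "0 \<le> d2" "0 \<le> d3" "d1 + d2 \<le> 1" "d2 + d3 \<le> 1" "d1 + d3 \<le> 1"
    and w: "0 \<le> w1" "0 \<le> w2" "0 \<le> w3"
  shows "w1 * d1 + w2 * d2 + w3 * d3 \<le> Max {w1, w2, w3, (w1 + w2 + w3) / 2}"
proof -
  \<comment> \<open>If one weight is at least the sum of the other two, the vertex with all degrees
    of freedom at that user is optimal, since the other coordinates are at most
    \<open>1 - a\<close>.\<close>
  have dominated: "x * a + y * b + z * c \<le> x"
    if "y + z \<le> x" "0 \<le> a" "a + b \<le> 1" "a + c \<le> 1" "0 \<le> b" "0 \<le> y" "0 \<le> z" for x y z a b c :: real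
  proof -
    have "x * a + y * b + z * c \<le> x * a + y * (1 - a) + z * (1 - a)"
      using that by (intro add_mono mult_left_mono) auto
    also have "\<dots> = x * a + (y + z) * (1 - a)" by (simp add: algebra_simps)
    also have "\<dots> \<le> x * a + x * (1 - a)"
      using that by (intro add_mono mult_right_mono) auto
    finally show ?thesis by (simp add: algebra_simps)
  qed
  consider "w2 + w3 \<le> w1" | "w1 + w3 \<le> w2" | "w1 + w2 \<le> w3"
    | "w1 \<le> w2 + w3" "w2 \<le> w1 + w3" "w3 \<le> w1 + w2" by linarith
  then show ?thesis
  proof cases
    case 1
    then have "w1 * d1 + w2 * d2 + w3 * d3 \<le> w1" using d w by (intro dominated) auto
    then show ?thesis by (simp add: le_max_iff_disj)
  next
    case 2
    then have "w2 * d2 + w1 * d1 + w3 * d3 \<le> w2" using d w by (intro dominated) auto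
    then show ?thesis by (simp add: le_max_iff_disj)
  next
    case 3
    then have "w3 * d3 + w1 * d1 + w2 * d2 \<le> w3" using d w by (intro dominated) auto
    then show ?thesis by (simp add: le_max_iff_disj)
  next
    case 4
    \<comment> \<open>Dual multipliers of the three pair constraints; the inequalities of this case
      make them nonnegative, and they add up to half of the total weight.\<close>
    have "w1 * d1 + w2 * d2 + w3 * d3 = (w1 + w2 - w3) / 2 * (d1 + d2)
        + (w2 + w3 - w1) / 2 * (d2 + d3) + (w1 + w3 - w2) / 2 * (d1 + d3)"
      by (simp add: field_simps)
    also have "\<dots> \<le> (w1 + w2 - w3) / 2 * 1 + (w2 + w3 - w1) / 2 * 1 + (w1 + w3 - w2) / 2 * 1"
      using 4 d by (intro add_mono mult_left_mono) auto
    also have "\<dots> = (w1 + w2 + w3) / 2" by (simp add: field_simps)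
    finally show ?thesis by (simp add: le_max_iff_disj)
  qed
qed

theorem theorem2:
  fixes \<mu> :: "complex measure" and hmin hmax :: real
  assumes "prob_space \<mu>"
    and "sets \<mu> = sets borel"
    and "absolutely_continuous lborel \<mu>"
    and "0 < hmin" and "hmin \<le> hmax"
    and "AE h in \<mu>. hmin \<le> cmod h \<and> cmod h \<le> hmax"
  shows "AE H in PiM UNIV (\<lambda>_::nat \<times> nat \<times> nat. \<mu>).
           dof_region H = {(d1, d2, d3). 0 \<le> d1 \<and> 0 \<le> d2 \<and> 0 \<le> d3 \<and>
              d1 + d2 \<le> 1 \<and> d2 + d3 \<le> 1 \<and> d1 + d3 \<le> 1}"
proof -
  interpret channel_law \<mu> hmin hmax
    using assms by (simp add: channel_law_def channel_law_axioms_def)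
  \<comment> \<open>Countably many determinants share one null set, so for a fixed channel the
    schemes of all sizes are available together.\<close>
  have "AE \<omega> in chan. \<forall>n. \<forall>k\<in>{..<3}. Determinant.det (Matrix.mat (2 * n + 1) (2 * n + 1)
      (\<lambda>(f, j). rx_entry k (if k = 0 then n + 1 else n) \<omega> f j)) \<noteq> 0"
    unfolding AE_all_countable
    by (intro allI AE_finite_allI) (auto intro: AE_rx_matrix_nonsingular)
  with AE_chan_bounds AE_chan_nonzero show ?thesis
  proof eventually_elim
    case (elim H)
    have pair: "weighted_dof H 1 1 0 \<le> 1" "weighted_dof H 0 1 1 \<le> 1" "weighted_dof H 1 0 1 \<le> 1"
    proof -
      have b: "\<And>k j f. hmin \<le> cmod (H (k, j, f)) \<and> cmod (H (k, j, f)) \<le> hmax"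
        using elim(1) by blast
      note ub = achievable_pair_bound[of hmin H hmax, OF assms(4) b]
      show "weighted_dof H 1 1 0 \<le> 1" by (rule weighted_dof_le_one) (use ub[of 0 1] in simp)
      show "weighted_dof H 0 1 1 \<le> 1" by (rule weighted_dof_le_one) (use ub[of 1 2] in simp)
      show "weighted_dof H 1 0 1 \<le> 1" by (rule weighted_dof_le_one) (use ub[of 0 2] in simp)
    qed
    have vertex: "ereal v \<le> weighted_dof H w1 w2 w3"
      if w: "0 \<le> w1" "0 \<le> w2" "0 \<le> w3" and v: "v \<in> {w1, w2, w3, (w1 + w2 + w3) / 2}" for w1 w2 w3 v
    proof -
      have single: "ereal ((w1 * real (if 0 = u then 1 else 0) + w2 * real (if 1 = u then 1 else 0)
          + w3 * real (if 2 = u then 1 else 0)) / real 1) \<le> weighted_dof H w1 w2 w3" for u :: nat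
      proof -
        interpret linear_scheme H 1 "\<lambda>k. if k = u then 1 else 0" "\<lambda>_ _ _. 1" "\<lambda>_ _ _. 1 / H (u, u, 0)"
          by (rule single_user_scheme) (use elim in blast)
        show ?thesis by (rule weighted_dof_ge[OF w])
      qed
      \<comment> \<open>For each \<open>n\<close> the power tends to infinity before
        \<open>n\<close> does, so the \<open>n\<close>-dependent rate offset of each scheme has
        already vanished.\<close>
      have half: "ereal ((w1 + w2 + w3) / 2) \<le> weighted_dof H w1 w2 w3"
      proof (rule Lim_bounded)
        show "(\<lambda>n. ereal ((w1 * real (n + 1) + w2 * real n + w3 * real n) / real (2 * n + 1)))
            \<longlonglongrightarrow> ereal ((w1 + w2 + w3) / 2)"
          by (rule tendsto_ereal) real_asymp
        show "\<forall>n\<ge>0. ereal ((w1 * real (n + 1) + w2 * real n + w3 * real n) / real (2 * n + 1))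
            \<le> weighted_dof H w1 w2 w3"
        proof (intro allI impI)
          fix n
          obtain U where "linear_scheme H (2 * n + 1) (\<lambda>k. if k = 0 then n + 1 else n)
              (\<lambda>k f i. beam k H f * loop_gain H f ^ i) U"
            by (rule alignment_scheme[of H n]) (use elim in auto)
          then interpret linear_scheme H "2 * n + 1" "\<lambda>k. if k = 0 then n + 1 else n"
              "\<lambda>k f i. beam k H f * loop_gain H f ^ i" U .
          show "ereal ((w1 * real (n + 1) + w2 * real n + w3 * real n) / real (2 * n + 1))
            \<le> weighted_dof H w1 w2 w3"
            using weighted_dof_ge[OF w] by simp
        qed
      qed
      have "ereal w1 \<le> weighted_dof H w1 w2 w3" "ereal w2 \<le> weighted_dof H w1 w2 w3"
          "ereal w3 \<le> weighted_dof H w1 w2 w3"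
        using single[of 0] single[of 1] single[of 2] by simp_all
      with v half show ?thesis by (elim insertE emptyE) (simp_all only:)
    qed
    show ?case
    proof (intro equalityI subsetI)
      fix d assume "d \<in> dof_region H"
      then obtain d1 d2 d3 where d: "d = (d1, d2, d3)" "0 \<le> d1" "0 \<le> d2" "0 \<le> d3"
        and le: "\<And>w1 w2 w3. 0 \<le> w1 \<Longrightarrow> 0 \<le> w2 \<Longrightarrow> 0 \<le> w3 \<Longrightarrow>
           ereal (w1 * d1 + w2 * d2 + w3 * d3) \<le> weighted_dof H w1 w2 w3"
        unfolding dof_region_def by blast
      \<comment> \<open>Composition with \<open>pair\<close> instantiates the free weights by 1, 1,
        0 and its permutations, the normals of the three facets.\<close>
      have "ereal (d1 + d2) \<le> ereal 1" "ereal (d2 + d3) \<le> ereal 1" "ereal (d1 + d3) \<le> ereal 1"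
        using order_trans[OF le pair(1)] order_trans[OF le pair(2)] order_trans[OF le pair(3)]
        by (simp_all add: one_ereal_def)
      then show "d \<in> {(d1, d2, d3). 0 \<le> d1 \<and> 0 \<le> d2 \<and> 0 \<le> d3 \<and>
              d1 + d2 \<le> 1 \<and> d2 + d3 \<le> 1 \<and> d1 + d3 \<le> 1}"
        using d by simp
    next
      fix d :: "real \<times> real \<times> real"
      assume "d \<in> {(d1, d2, d3). 0 \<le> d1 \<and> 0 \<le> d2 \<and> 0 \<le> d3 \<and>
              d1 + d2 \<le> 1 \<and> d2 + d3 \<le> 1 \<and> d1 + d3 \<le> 1}"
      then obtain d1 d2 d3 where d: "d = (d1, d2, d3)" "0 \<le> d1" "0 \<le> d2" "0 \<le> d3"
        "d1 + d2 \<le> 1" "d2 + d3 \<le> 1" "d1 + d3 \<le> 1" by auto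
      have "ereal (w1 * d1 + w2 * d2 + w3 * d3) \<le> weighted_dof H w1 w2 w3"
        if w: "0 \<le> w1" "0 \<le> w2" "0 \<le> w3" for w1 w2 w3
      proof -
        have "ereal (w1 * d1 + w2 * d2 + w3 * d3) \<le> ereal (Max {w1, w2, w3, (w1 + w2 + w3) / 2})"
          using weighted_sum_le_vertex_max[OF d(2-7) w] by (simp only: ereal_less_eq)
        also have "\<dots> \<le> weighted_dof H w1 w2 w3"
          by (rule vertex[OF w]) (rule Max_in, auto)
        finally show ?thesis .
      qed
      then show "d \<in> dof_region H" using d unfolding dof_region_def by blast
    qed
  qed
qed

end
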